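(* Let $Q$ be a finite set of order $k\ge 4$. (1) Convolution with respect to any quasigroup operation on $Q$ preserves $\mathcal B_k$: if $\star$ is a quasigroup operation on $Q$ and $\mu,\nu$ are probability laws on $Q$ in $\mathcal B_k$, then the convolution of $\mu$ and $\nu$ with respect to $\star$ lies in $\mathcal B_k$. (2) Convolution with respect to any absorbing-zero quasigroup operation on $Q$ (with respect to any distinguished element $0\in Q$) preserves $\mathcal B_k$ in the same sense. Consequently, an ordinary quasigroup operation (addition) and an absorbing-zero quasigroup operation (multiplication) on $Q$ both preserve $\mathcal B_k$, with no compatibility law between the two operations.
   Context: For an integer $k\ge 2$ and $t\in[0,1]$ put $\psi_k(t):=\dfrac{1-t-(1-t)^k}{k-1}$. For a probability law $p$ on a set of $k$ points, let $p_1^{\downarrow}\ge p_2^{\downarrow}\ge\cdots\ge p_k^{\downarrow}$ be its atoms sorted in decreasing order (with multiplicity). The body $\mathcal B_k$ is the set of probability laws $p$ on $k$ points with $p_k^{\downarrow}\ge\psi_k(p_2^{\downarrow})$. A binary operation $\star$ on a finite set $Q$ is a quasigroup operation if for every $a\in Q$ both translations $x\mapsto a\star x$ and $x\mapsto x\star a$ are permutations of $Q$ (no identity, associativity or commutativity is assumed). If $Q$ has a distinguished element $0$, an operation $\diamond$ on $Q$ is an absorbing-zero quasigroup operation if $0\diamond x=x\diamond 0=0$ for all $x\in Q$ and $\diamond$ restricts to a quasigroup operation on $Q^\times:=Q\setminus\{0\}$. For an operation $\circ$ on $Q$ and laws $\mu,\nu$ on $Q$, their convolution with respect to $\circ$ is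 the law $g\mapsto\sum_{(h,h')\in Q\times Q:\ h\circ h'=g}\mu(h)\nu(h')$, i.e. the law of $X\circ Y$ for independent $X\sim\mu$, $Y\sim\nu$. *)

theory Defs
  imports "HOL-Probability.Probability"
begin

definition psi :: "nat \<Rightarrow> real \<Rightarrow> real" where
  "psi k t = (1 - t - (1 - t) ^ k) / (real k - 1)"

text \<open>A probability law on a finite set \<open>Q\<close> is a \<open>pmf\<close> whose support is contained in \<open>Q\<close>.
  Points of \<open>Q\<close> outside the support count as atoms of mass 0.\<close>

definition laws_on :: "'a set \<Rightarrow> 'a pmf set" where
  "laws_on Q = {p. set_pmf p \<subseteq> Q}"

definition decreasing_atoms :: "'a set \<Rightarrow> 'a pmf \<Rightarrow> real list" where
  "decreasing_atoms Q p = rev (sorted_list_of_multiset (image_mset (pmf p) (mset_set Q)))"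

text \<open>The index is 1-based, and \<open>atom_at Q p i\<close> is meant for \<open>1 \<le> i \<le> card Q\<close> with \<open>Q\<close> finite.\<close>

definition atom_at :: "'a set \<Rightarrow> 'a pmf \<Rightarrow> nat \<Rightarrow> real" where
  "atom_at Q p i = decreasing_atoms Q p ! (i - 1)"

text \<open>The body of index \<open>k\<close>, realised on the finite set \<open>Q\<close>, which must have \<open>k\<close> elements.\<close>

definition body :: "nat \<Rightarrow> 'a set \<Rightarrow> 'a pmf set" where
  "body k Q = {p \<in> laws_on Q. atom_at Q p k \<ge> psi k (atom_at Q p 2)}"

text \<open>Closure of \<open>Q\<close> under the operation is part of \<open>bij_betw\<close>; values outside \<open>Q\<close> are
  unconstrained.\<close>

definition quasigroup_on :: "'a set \<Rightarrow> ('a \<Rightarrow> 'a \<Rightarrow> 'a) \<Rightarrow> bool" where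
  "quasigroup_on Q f \<longleftrightarrow>
     (\<forall>a\<in>Q. bij_betw (\<lambda>x. f a x) Q Q \<and> bij_betw (\<lambda>x. f x a) Q Q)"

definition absorbing_zero_quasigroup_on :: "'a set \<Rightarrow> 'a \<Rightarrow> ('a \<Rightarrow> 'a \<Rightarrow> 'a) \<Rightarrow> bool" where
  "absorbing_zero_quasigroup_on Q z f \<longleftrightarrow>
     z \<in> Q \<and> (\<forall>x\<in>Q. f z x = z \<and> f x z = z) \<and> quasigroup_on (Q - {z}) f"

definition conv :: "('a \<Rightarrow> 'a \<Rightarrow> 'a) \<Rightarrow> 'a pmf \<Rightarrow> 'a pmf \<Rightarrow> 'a pmf" where
  "conv f \<mu> \<nu> = map_pmf (\<lambda>(x, y). f x y) (pair_pmf \<mu> \<nu>)"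

lemma pmf_conv:
  assumes "finite Q" "\<mu> \<in> laws_on Q" "\<nu> \<in> laws_on Q"
  shows "pmf (conv f \<mu> \<nu>) g =
    (\<Sum>(h, h') \<in> {(h, h') \<in> Q \<times> Q. f h h' = g}. pmf \<mu> h * pmf \<nu> h')"
proof -
  let ?S = "{(h, h') \<in> Q \<times> Q. f h h' = g}"
  let ?V = "(\<lambda>(x, y). f x y) -` {g}"
  have fin: "finite ?S"
    using assms(1) by (auto intro: finite_subset[of _ "Q \<times> Q"])
  have "pmf (conv f \<mu> \<nu>) g = measure (pair_pmf \<mu> \<nu>) ?V"
    by (simp add: conv_def pmf_map)
  also have "\<dots> = measure (pair_pmf \<mu> \<nu>) ?S"
    using assms(2,3) by (intro measure_eq_AE) (auto simp: AE_measure_pmf_iff laws_on_def)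
  also have "\<dots> = sum (pmf (pair_pmf \<mu> \<nu>)) ?S"
    by (rule measure_measure_pmf_finite[OF fin])
  also have "\<dots> = (\<Sum>(h, h') \<in> ?S. pmf \<mu> h * pmf \<nu> h')"
    by (intro sum.cong) (auto simp: pmf_pair)
  finally show ?thesis .
qed

definition conv_preserves :: "('a \<Rightarrow> 'a \<Rightarrow> 'a) \<Rightarrow> 'a pmf set \<Rightarrow> bool" where
  "conv_preserves f B \<longleftrightarrow> (\<forall>\<mu>\<in>B. \<forall>\<nu>\<in>B. conv f \<mu> \<nu> \<in> B)"

end

theory Submission
  imports Defs
begin

text \<open>
  Write \<open>k = n + 1\<close>. The convolution of two laws need only be compared with a bound \<open>M\<close> for all of its
  atoms except one, and a bound \<open>m\<close> from below for all of them: if \<open>psi k s \<le> m\<close> for every \<open>s \<le> M\<close>, then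
  the convolution lies in the body (\<open>body_intro\<close>). A law of the body enters only through the position
  \<open>a\<close> of a largest atom, its second largest atom \<open>t\<close>, and the bound \<open>psi k t\<close> below all of its atoms
  (\<open>peaked_at\<close>). Subtracting this bound from the law leaves a nonnegative excess, and every atom of a
  quasigroup convolution is an explicit constant plus a sum \<open>\<Sum>h. e h * f (\<pi> h)\<close> of paired excesses,
  with \<open>\<pi>\<close> a permutation.

  For a quasigroup on \<open>Q\<close>, at all points but one the permutation does not match the two largest atoms,
  which bounds the paired sum. In the coordinates ``total excess'' and ``excess off the second atom
  minus excess at the second atom'' (\<open>spread\<close> and \<open>lead\<close>) the extremal laws multiply coordinatewise, so
  that the claim says that the curve (\<open>spread\<close>, \<open>lead\<close>) lies below its coordinatewise products. It does,
  because \<open>- ln lead\<close> is a convex function of \<open>- ln spread\<close> that vanishes at \<open>0\<close>, and such a function is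
  superadditive (\<open>lead_le_product\<close>).

  For an absorbing zero \<open>z\<close>, let \<open>S\<close> and \<open>T\<close> be the masses of the two laws off \<open>z\<close>. The convolution has
  mass \<open>1 - S * T\<close> at \<open>z\<close>, and off \<open>z\<close> it is a quasigroup convolution. The argument depends on where the
  largest atoms sit.
  \<^item> If neither is at \<open>z\<close>, then the extremal laws have their second atom at \<open>z\<close>. The function \<open>psi\<close> is
    made for this case: off \<open>z\<close> the excess of total mass at most \<open>x ^ k\<close>, where \<open>x\<close> is the mass off \<open>z\<close>,
    is multiplicative. When the mass at \<open>z\<close> exceeds the point where \<open>psi\<close> is largest, a second estimate is
    needed, comparing the two preimages of a value under \<open>x - x ^ k\<close> (\<open>conjugate_gap\<close>).
  \<^item> If exactly one is at \<open>z\<close>, the other law acts on the first by a contraction with factor \<open>T\<close>; the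
    claim becomes a bound by \<open>k\<close> on a logarithmic derivative (\<open>bern_reciprocal_le\<close>). On the range of second
    atoms that occur this bound holds for \<open>k \<ge> 4\<close> and fails for \<open>k = 3\<close>.
  \<^item> If both are at \<open>z\<close>, both excesses are spread over \<open>Q - {z}\<close>; a scaling argument reduces the claim to
    a polynomial inequality in the ratio \<open>psi k t / t\<close> and in the number of atoms that carry the excess
    (\<open>two_zero_peaks_bound\<close>).
\<close>

section \<open>The function psi and its maximum\<close>

text \<open>Up to the factor \<open>n\<close> this is \<open>psi (Suc n)\<close> in the variable \<open>x = 1 - t\<close>, the mass off the second atom.\<close>

definition gap :: "nat \<Rightarrow> real \<Rightarrow> real" where
  "gap n x = x - x ^ Suc n"

text \<open>The point where \<open>gap n\<close> attains its maximum on \<open>{0..}\<close>.\<close>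

definition peak :: "nat \<Rightarrow> real" where
  "peak n = root n (1 / (real n + 1))"

lemma psi_eq_gap: "psi (Suc n) t = gap n (1 - t) / real n"
  by (simp add: psi_def gap_def)

lemma peak_power: "n > 0 \<Longrightarrow> peak n ^ n = 1 / (real n + 1)"
  by (simp add: peak_def)

lemma peak_pos: "n > 0 \<Longrightarrow> 0 < peak n"
  by (simp add: peak_def)

lemma peak_less_1: "n > 0 \<Longrightarrow> peak n < 1"
  unfolding peak_def by simp

lemma gap_peak:
  assumes "n > 0" shows "gap n (peak n) = peak n * real n / (real n + 1)"
proof -
  have "gap n (peak n) = peak n - peak n * peak n ^ n" by (simp add: gap_def)
  then show ?thesis unfolding peak_power[OF assms] by (simp add: field_simps)
qed

lemma gap_has_derivative:
  "(gap n has_real_derivative 1 - (real n + 1) * x ^ n) (at x)"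
proof -
  have "((\<lambda>x. x - x ^ Suc n) has_real_derivative 1 - real (Suc n) * x ^ n) (at x)"
    by (auto intro!: derivative_eq_intros simp del: power_Suc)
  then show ?thesis by (simp add: gap_def[abs_def] add.commute)
qed

lemma gap_mono:
  assumes n: "n > 0" and "0 \<le> x" "x \<le> y" "y \<le> peak n" shows "gap n x \<le> gap n y"
proof (rule DERIV_nonneg_imp_nondecreasing[OF \<open>x \<le> y\<close>])
  fix u assume u: "x \<le> u" "u \<le> y"
  have "u ^ n \<le> peak n ^ n" using u assms by (intro power_mono) auto
  then have "0 \<le> 1 - (real n + 1) * u ^ n"
    unfolding peak_power[OF n] by (simp add: field_simps)
  then show "\<exists>d. (gap n has_real_derivative d) (at u) \<and> 0 \<le> d"
    using gap_has_derivative by blast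
qed

lemma gap_antimono:
  assumes n: "n > 0" and "peak n \<le> x" "x \<le> y" shows "gap n y \<le> gap n x"
proof (rule DERIV_nonpos_imp_nonincreasing[OF \<open>x \<le> y\<close>])
  fix u assume u: "x \<le> u" "u \<le> y"
  have "peak n ^ n \<le> u ^ n" using u assms peak_pos[OF n] by (intro power_mono) auto
  then have "1 - (real n + 1) * u ^ n \<le> 0"
    unfolding peak_power[OF n] by (simp add: field_simps)
  then show "\<exists>d. (gap n has_real_derivative d) (at u) \<and> d \<le> 0"
    using gap_has_derivative by blast
qed

lemma gap_le_peak: "n > 0 \<Longrightarrow> 0 \<le> x \<Longrightarrow> gap n x \<le> gap n (peak n)"
  by (cases "x \<le> peak n") (auto intro: gap_mono gap_antimono)

lemma gap_nonneg: "0 \<le> x \<Longrightarrow> x \<le> 1 \<Longrightarrow> 0 \<le> gap n x"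
  using power_decreasing[of 1 "Suc n" x] by (simp add: gap_def)

text \<open>The defect in Bernoulli's inequality \<open>x ^ Suc n \<ge> 1 + Suc n * (x - 1)\<close>. By \<open>psi_eq_bern\<close> below,
  \<open>bern n (1 - t) / n\<close> is the largest amount by which a second atom \<open>t\<close> may exceed the smallest one.\<close>

definition bern :: "nat \<Rightarrow> real \<Rightarrow> real" where
  "bern n x = real n - (real n + 1) * x + x ^ Suc n"

lemma bern_nonneg: "0 \<le> x \<Longrightarrow> 0 \<le> bern n x"
  using Bernoulli_inequality[of "x - 1" "Suc n"] by (simp add: bern_def algebra_simps)

text \<open>This is the inequality between arithmetic and geometric mean for a geometric progression. Stating it
  for an even base \<open>p\<^sup>2\<close> avoids half-integer exponents.\<close>

lemma sum_even_powers_ge: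
  fixes p :: real assumes "0 \<le> p"
  shows "(real n + 1) * p ^ n \<le> (\<Sum>i\<le>n. (p\<^sup>2) ^ i)"
proof (induction n)
  case (Suc n)
  have "0 \<le> p ^ n * bern (Suc n) p"
    using bern_nonneg assms by simp
  also have "\<dots> = (real n + 1) * p ^ n + (p\<^sup>2) ^ Suc n - (real (Suc n) + 1) * p ^ Suc n"
    by (simp add: bern_def algebra_simps power_add power2_eq_square power_mult_distrib)
  finally show ?case using Suc by simp
qed simp

text \<open>The second factor is \<open>r + ... + r ^ (n - 1)\<close>, so this is the product of two instances of the previous
  inequality, for \<open>n + 1\<close> and for \<open>n - 1\<close> terms.\<close>

lemma geometric_sum_product_ge:
  fixes r :: real assumes "0 \<le> r" and "n > 0"
  defines "s \<equiv> \<Sum>i\<le>n. r ^ i"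
  shows "((real n)\<^sup>2 - 1) * r ^ n \<le> s * (s - 1 - r ^ n)"
proof (cases "n = 1")
  case True then show ?thesis by (simp add: s_def)
next
  case False
  then obtain j where n: "n = Suc (Suc j)" using \<open>n > 0\<close> by (metis One_nat_def not0_implies_Suc less_irrefl)
  define p where "p = sqrt r"
  have p: "0 \<le> p" "r = p\<^sup>2" using assms by (auto simp: p_def)
  have mid: "s - 1 - r ^ n = r * (\<Sum>i\<le>j. r ^ i)"
    unfolding s_def n by (simp add: sum.atMost_Suc[of _ "Suc j"] sum.atMost_Suc_shift[of _ j]
        sum_distrib_left del: sum.atMost_Suc)
  have "((real n)\<^sup>2 - 1) * r ^ n = ((real n + 1) * p ^ n) * (r * ((real j + 1) * p ^ j))"
    unfolding p(2) n by (simp add: algebra_simps power2_eq_square power_mult_distrib)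
  also have "\<dots> \<le> s * (r * (\<Sum>i\<le>j. r ^ i))"
    unfolding s_def p(2)
    by (intro mult_mono sum_even_powers_ge p mult_nonneg_nonneg sum_nonneg zero_le_power) (auto simp: p)
  finally show ?thesis unfolding mid .
qed

lemma geometric_sum_derivative:
  fixes r :: real
  shows "(1 - r) * (\<Sum>i\<le>n. real i * r ^ (i - 1)) = (\<Sum>i\<le>n. r ^ i) - (real n + 1) * r ^ n"
proof (induction n)
  case (Suc n)
  show ?case unfolding sum.atMost_Suc distrib_left Suc
    by (cases n) (simp_all add: algebra_simps)
qed simp

text \<open>Both sides are \<open>1\<close> at \<open>r = 0\<close>, and the logarithm of their quotient is monotone: after multiplication
  by \<open>1 - r\<close> its derivative is, up to a positive factor, the difference in
  \<open>geometric_sum_product_ge\<close>. The odd-looking base is what a pair of points with equal \<open>gap\<close> and ratio \<open>r\<close>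
  produces in \<open>conjugate_gap\<close>.\<close>

lemma power_le_geometric_sum:
  fixes r :: real and n :: nat
  assumes n: "n > 0" and r: "0 \<le> r" "r \<le> 1"
  shows "(1 / n + r + (real n - 1) / (n * (\<Sum>i\<le>n. r ^ i))) ^ n \<le> (\<Sum>i\<le>n. r ^ i)"
proof -
  define s where "s = (\<lambda>r::real. \<Sum>i\<le>n. r ^ i)"
  define s' where "s' = (\<lambda>r::real. \<Sum>i\<le>n. real i * r ^ (i - 1))"
  define B where "B = (\<lambda>r. 1 / n + r + (real n - 1) / (n * s r))"
  define B' where "B' = (\<lambda>r. 1 - (real n - 1) * s' r / (n * (s r)\<^sup>2))"
  have s1: "1 \<le> s r" if "0 \<le> r" for r
  proof -
    have "(\<Sum>i\<le>0. r ^ i) \<le> s r" unfolding s_def using that by (intro sum_mono2) auto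
    then show ?thesis by simp
  qed
  have B0: "0 < B r" if "0 \<le> r" for r
  proof -
    have "0 \<le> (real n - 1) / (n * s r)" using n s1[OF that] by simp
    then show ?thesis unfolding B_def using n that by (simp add: add_pos_nonneg)
  qed
  have ds: "(s has_real_derivative s' r) (at r)" for r
    unfolding s_def s'_def by (auto intro!: derivative_eq_intros sum.cong)
  have dB: "(B has_real_derivative B' r) (at r)" if "0 \<le> r" for r
    unfolding B_def B'_def using s1[OF that] n
    by (auto intro!: derivative_eq_intros ds simp: power2_eq_square field_simps)
  have dW: "((\<lambda>r. ln (s r) - n * ln (B r)) has_real_derivative s' r / s r - n * (B' r / B r)) (at r)"
    if "0 \<le> r" for r
    using s1[OF that] B0[OF that] that by (auto intro!: derivative_eq_intros ds dB)
  have key: "0 \<le> s' r / s r - n * (B' r / B r)" if r: "0 \<le> r" "r < 1" for r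
  proof -
    have sp: "s r > 0" using s1[of r] r by linarith
    have e1: "(1 - r) * s' r = s r - (real n + 1) * r ^ n"
      unfolding s_def s'_def by (rule geometric_sum_derivative)
    have e2: "r * s r = s r - 1 + r * r ^ n"
      using sum_gp_basic[of r n] unfolding s_def by (simp add: algebra_simps)
    have "(1 - r) * (n * s r * (s' r * B r - n * s r * B' r))
      = ((1 - r) * s' r) * (s r * (1 + n * r) + (real n)\<^sup>2 - 1) - (real n)\<^sup>2 * s r * (s r - r * s r)"
      unfolding B_def B'_def using n sp by (simp add: field_simps power2_eq_square)
    also have "\<dots> = (real n + 1) * (s r * (s r - 1 - r ^ n) - ((real n)\<^sup>2 - 1) * r ^ n)"
    proof -
      have "s r * (1 + n * r) = s r + n * (r * s r)" by (simp add: algebra_simps)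
      then have "s r * (1 + n * r) = s r + n * (s r - 1 + r * r ^ n)" unfolding e2 .
      then have *: "s r * (1 + n * r) + (real n)\<^sup>2 - 1
          = s r + n * (s r - 1 + r * r ^ n) + (real n)\<^sup>2 - 1" by simp
      have "s r - r * s r = 1 - r * r ^ n" using e2 by simp
      have alg: "(u - (N + 1) * a) * (u + N * (u - 1 + r * a) + N\<^sup>2 - 1) - N\<^sup>2 * u * (1 - r * a)
          = (N + 1) * (u * (u - 1 - a) - (N\<^sup>2 - 1) * a) + N * (N + 1) * a * (r * u - (u - 1 + r * a))"
        for N u a :: real by (simp add: algebra_simps power2_eq_square)
      show ?thesis unfolding e1 * \<open>s r - r * s r = 1 - r * r ^ n\<close>
        by (subst alg) (simp only: e2 diff_self mult_zero_right add_0_right)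
    qed
    also have "\<dots> \<ge> 0" using geometric_sum_product_ge[OF r(1) n] unfolding s_def by simp
    finally have "0 \<le> n * s r * (s' r * B r - n * s r * B' r)"
      using r by (simp add: zero_le_mult_iff)
    moreover have "0 < n * s r" using n sp by simp
    ultimately have "0 \<le> s' r * B r - n * s r * B' r"
      by (metis zero_le_mult_iff not_le)
    then show ?thesis using sp B0[OF r(1)] by (simp add: field_simps)
  qed
  have "ln (s 0) - n * ln (B 0) \<le> ln (s r) - n * ln (B r)"
  proof (rule DERIV_nonneg_imp_increasing_open[OF r(1)])
    show "\<exists>y. ((\<lambda>r. ln (s r) - n * ln (B r)) has_real_derivative y) (at u) \<and> 0 \<le> y" if "0 < u" "u < r" for u
      using dW[of u] key[of u] that r by auto
    show "continuous_on {0..r} (\<lambda>r. ln (s r) - n * ln (B r))"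
      using dW by (intro DERIV_atLeastAtMost_imp_continuous_on) auto
  qed
  moreover have "s 0 = 1" "B 0 = 1" unfolding B_def s_def using n by (simp_all add: field_simps power_0_left)
  ultimately have "n * ln (B r) \<le> ln (s r)" by simp
  then have "ln (B r ^ n) \<le> ln (s r)" using B0[OF r(1)] by (simp add: ln_realpow)
  then have "B r ^ n \<le> s r" using B0[OF r(1)] s1[OF r(1)] by (simp add: ln_le_cancel_iff)
  then show ?thesis unfolding B_def s_def .
qed

text \<open>The case \<open>r = 1\<close> of the preceding inequality.\<close>

lemma peak_le:
  assumes n: "n > 0" shows "peak n * (real n + 3) \<le> real n + 1"
proof -
  have "((real n + 3) / (real n + 1)) ^ n \<le> real n + 1"
  proof -
    have "1 / real n + 1 + (real n - 1) / (real n * (\<Sum>i\<le>n. 1 ^ i)) = (real n + 3) / (real n + 1)"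
    proof -
      have "1 / N + 1 + (N - 1) / (N * (N + 1)) = (N + 3) / (N + 1)" if "N > 0" for N :: real
      proof -
        have "N \<noteq> 0" "N + 1 \<noteq> 0" using that by auto
        then show ?thesis by (simp add: divide_simps) algebra
      qed
      from this[of "real n"] show ?thesis using n by (simp add: add.commute distrib_left)
    qed
    note eq = this
    show ?thesis using power_le_geometric_sum[OF n, of 1] unfolding eq by simp
  qed
  then have "(peak n * ((real n + 3) / (real n + 1))) ^ n \<le> 1 ^ n"
    unfolding power_mult_distrib peak_power[OF n] by (simp add: divide_le_eq)
  then have "peak n * ((real n + 3) / (real n + 1)) \<le> 1"
    using n one_less_power by (metis not_le power_one)
  then show ?thesis by (simp add: field_simps)
qed

text \<open>Let \<open>Z \<ge> peak n\<close> be the other point with \<open>gap n Z = gap n X\<close>. With \<open>r = X / Z\<close>, the equality of the two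
  gaps says \<open>Z ^ n * (\<Sum>i\<le>n. r ^ i) = 1\<close>, and \<open>power_le_geometric_sum\<close> turns into \<open>Z \<le> Y\<close>. The bound is used
  for laws with largest atom \<open>1 - X\<close>, smallest atom \<open>gap n X / n\<close> and second atom \<open>1 - Y\<close>.\<close>

lemma conjugate_gap:
  assumes n: "n > 0" and X: "0 \<le> X" "X \<le> peak n"
  defines "Y \<equiv> 1 - X + (real n - 1) / n * gap n X"
  shows "peak n \<le> Y" "gap n Y \<le> gap n X"
proof -
  have "\<exists>Z\<ge>peak n. Z \<le> 1 \<and> gap n Z = gap n X"
  proof (rule IVT2)
    show "gap n X \<le> gap n (peak n)" using gap_le_peak n X by auto
    show "gap n 1 \<le> gap n X"
      using gap_nonneg[of X n] X peak_less_1[OF n] by (simp add: gap_def)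
    show "peak n \<le> 1" using peak_less_1[OF n] by simp
    show "\<forall>x. peak n \<le> x \<and> x \<le> 1 \<longrightarrow> isCont (gap n) x"
      using DERIV_isCont gap_has_derivative by blast
  qed
  then obtain Z where Z: "peak n \<le> Z" "Z \<le> 1" "gap n Z = gap n X" by blast
  have Zp: "Z > 0" using Z peak_pos[OF n] by linarith
  define r where "r = X / Z"
  define s where "s = (\<Sum>i\<le>n. r ^ i)"
  have r: "0 \<le> r" "r \<le> 1" and X': "X = r * Z" using X Z Zp by (auto simp: r_def)
  have Zs: "Z ^ n * s = 1"
  proof (cases "r = 1")
    case True
    then have "Z = peak n" using X' X Z by auto
    then show ?thesis using True peak_power[OF n] by (simp add: s_def)
  next
    case False
    have gp: "(1 - r) * s = 1 - r ^ Suc n" unfolding s_def by (rule sum_gp_basic)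
    have "Z - Z * Z ^ n = r * Z - r ^ Suc n * (Z * Z ^ n)"
      using Z(3) unfolding gap_def X' by (simp add: power_mult_distrib)
    then have "Z * (1 - r) = Z * (Z ^ n * (1 - r ^ Suc n))" by (simp add: algebra_simps)
    then have "1 - r = Z ^ n * ((1 - r) * s)" using Zp unfolding gp by simp
    then have "(1 - r) * (Z ^ n * s) = (1 - r) * 1" by (simp add: algebra_simps)
    then show ?thesis using False by simp
  qed
  define B where "B = 1 / n + r + (real n - 1) / (n * s)"
  have sp: "s \<noteq> 0" using Zs by auto
  have "(Z * B) ^ n \<le> Z ^ n * s"
    unfolding power_mult_distrib B_def s_def
    using power_le_geometric_sum[OF n r] Zp by (intro mult_left_mono) auto
  then have "(Z * B) ^ n \<le> 1 ^ n" unfolding Zs by simp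
  then have ZB: "Z * B \<le> 1"
    using n one_less_power by (metis not_le power_one)
  have "Z / s = Z * (Z ^ n * s) / s" unfolding Zs by simp
  also have "\<dots> = Z * Z ^ n" using sp by simp
  finally have "Z / s = Z * Z ^ n" .
  moreover have "Z * B = Z / n + r * Z + (real n - 1) / n * (Z / s)"
    by (simp add: B_def distrib_left mult.commute)
  ultimately have "Z * B = Z / n + X + (real n - 1) / n * (Z * Z ^ n)" unfolding X' by simp
  also have "\<dots> = X + Z - (real n - 1) / n * gap n Z"
  proof -
    define c where "c = (real n - 1) / n"
    have "Z / n = Z - c * Z" unfolding c_def using n by (simp add: field_simps)
    then show ?thesis unfolding gap_def c_def[symmetric] by (simp add: algebra_simps)
  qed
  finally have "Z \<le> Y" using ZB Z(3) unfolding Y_def by simp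
  then show "peak n \<le> Y" "gap n Y \<le> gap n X"
    using Z gap_antimono[OF n Z(1)] by auto
qed

text \<open>With \<open>x = 1 - t\<close> the hypothesis says \<open>2 * t + (n - 1) * psi (Suc n) t \<le> 1\<close>, which holds for the second atom
  of every law in the body. Hence only the increasing branch of \<open>psi\<close> matters for such laws.\<close>

lemma peak_le_of_lead_nonneg:
  assumes n: "n > 0" and x: "0 \<le> x" and D: "real n \<le> (real n + 1) * x + (real n - 1) * x ^ Suc n"
  shows "peak n \<le> x"
proof (rule ccontr)
  assume "\<not> peak n \<le> x"
  then have lt: "x < peak n" by simp
  have "x ^ Suc n \<le> peak n ^ Suc n" using lt x by (intro power_mono) auto
  then have "(real n - 1) * x ^ Suc n \<le> (real n - 1) * (peak n * (1 / (real n + 1)))"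
    using n peak_power[OF n] by (intro mult_left_mono) auto
  moreover have "(real n + 1) * x < (real n + 1) * peak n" using lt by simp
  ultimately have "real n < (real n + 1) * peak n + (real n - 1) * (peak n * (1 / (real n + 1)))"
    using D by linarith
  also have "\<dots> = real n * (peak n * (real n + 3)) / (real n + 1)" by (simp add: divide_simps) (simp add: algebra_simps)
  also have "\<dots> \<le> real n * (real n + 1) / (real n + 1)"
    using peak_le[OF n] by (intro divide_right_mono mult_left_mono) auto
  also have "\<dots> = real n" by simp
  finally show False by simp
qed

section \<open>Total excess and its lead over the second atom\<close>

lemma bern_has_derivative:
  "(bern n has_real_derivative (real n + 1) * (x ^ n - 1)) (at x)"
proof -
  have "((\<lambda>x. real n - (real n + 1) * x + x ^ Suc n) has_real_derivative
      - (real n + 1) + real (Suc n) * x ^ n) (at x)"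
    by (auto intro!: derivative_eq_intros simp del: power_Suc)
  then show ?thesis by (simp add: bern_def[abs_def] algebra_simps)
qed

lemma bern_antimono:
  assumes "0 \<le> x" "x \<le> y" "y \<le> 1" shows "bern n y \<le> bern n x"
proof (rule DERIV_nonpos_imp_nonincreasing[OF \<open>x \<le> y\<close>])
  fix u assume u: "x \<le> u" "u \<le> y"
  have "u ^ n \<le> 1" using u assms by (intro power_le_one) auto
  then have "(real n + 1) * (u ^ n - 1) \<le> 0" by (simp add: mult_le_0_iff)
  then show "\<exists>d. (bern n has_real_derivative d) (at u) \<and> d \<le> 0"
    using bern_has_derivative by blast
qed

lemma psi_eq_bern: "n > 0 \<Longrightarrow> psi (Suc n) t = t - bern n (1 - t) / real n"
  unfolding psi_eq_gap gap_def bern_def by (simp add: field_simps)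

lemma psi_le_self: "n > 0 \<Longrightarrow> t \<le> 1 \<Longrightarrow> psi (Suc n) t \<le> t"
  using bern_nonneg[of "1 - t" n] by (simp add: psi_eq_bern)

lemma psi_nonneg: "0 \<le> t \<Longrightarrow> t \<le> 1 \<Longrightarrow> 0 \<le> psi (Suc n) t"
  using gap_nonneg[of "1 - t" n] by (simp add: psi_eq_gap)

text \<open>For a law with second atom \<open>1 - x\<close> and smallest atom \<open>m = psi (Suc n) (1 - x)\<close>, subtract \<open>m\<close> from every
  atom. What remains has total mass \<open>spread n x\<close>: it is \<open>bern n x / n\<close> at the second atom and \<open>x ^ Suc n\<close>
  elsewhere. The difference of these two parts is \<open>lead n x\<close>.\<close>

definition spread :: "nat \<Rightarrow> real \<Rightarrow> real" where
  "spread n x = x ^ Suc n + bern n x / n"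

definition lead :: "nat \<Rightarrow> real \<Rightarrow> real" where
  "lead n x = x ^ Suc n - bern n x / n"

lemma spread_eq: "n > 0 \<Longrightarrow> spread n x = 1 - (real n + 1) * (gap n x / n)"
  unfolding spread_def bern_def gap_def by (simp add: field_simps)

lemma lead_eq: "n > 0 \<Longrightarrow> lead n x = 2 * x - 1 - (real n - 1) * (gap n x / n)"
  unfolding lead_def bern_def gap_def by (simp add: field_simps)

lemma lead_nonneg_iff:
  assumes "n > 0"
  shows "0 \<le> lead n x \<longleftrightarrow> real n \<le> (real n + 1) * x + (real n - 1) * x ^ Suc n"
proof -
  have "real n * lead n x = (real n + 1) * x + (real n - 1) * x ^ Suc n - real n"
    unfolding lead_def bern_def using assms by (simp add: field_simps)
  moreover have "0 \<le> lead n x \<longleftrightarrow> 0 \<le> real n * lead n x"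
    using assms by (simp add: zero_le_mult_iff)
  ultimately show ?thesis by linarith
qed

lemma spread_has_derivative:
  assumes "n > 0"
  shows "(spread n has_real_derivative (real n + 1) / n * ((real n + 1) * x ^ n - 1)) (at x)"
proof -
  have "((\<lambda>x. x ^ Suc n + bern n x / n) has_real_derivative
      real (Suc n) * x ^ n + (real n + 1) * (x ^ n - 1) / n) (at x)"
    using assms by (auto intro!: derivative_eq_intros bern_has_derivative simp del: power_Suc)
  moreover have "real (Suc n) * x ^ n + (real n + 1) * (x ^ n - 1) / n
      = (real n + 1) / n * ((real n + 1) * x ^ n - 1)"
    using assms by (auto simp add: divide_simps) (simp_all add: algebra_simps)
  ultimately show ?thesis unfolding spread_def[abs_def] by (simp del: power_Suc)
qed

lemma lead_has_derivative:
  assumes "n > 0"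
  shows "(lead n has_real_derivative (real n + 1) / n * (1 + (real n - 1) * x ^ n)) (at x)"
proof -
  have "((\<lambda>x. x ^ Suc n - bern n x / n) has_real_derivative
      real (Suc n) * x ^ n - (real n + 1) * (x ^ n - 1) / n) (at x)"
    using assms by (auto intro!: derivative_eq_intros bern_has_derivative simp del: power_Suc)
  moreover have "real (Suc n) * x ^ n - (real n + 1) * (x ^ n - 1) / n
      = (real n + 1) / n * (1 + (real n - 1) * x ^ n)"
    using assms by (auto simp add: divide_simps) (simp_all add: algebra_simps)
  ultimately show ?thesis unfolding lead_def[abs_def] by (simp del: power_Suc)
qed

lemma spread_strict_mono:
  assumes n: "n > 0" and "peak n \<le> x" "x < y" shows "spread n x < spread n y"
proof (rule DERIV_pos_imp_increasing_open[OF \<open>x < y\<close>])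
  fix u assume u: "x < u" "u < y"
  have "peak n ^ n < u ^ n"
    using u assms peak_pos[OF n] by (intro power_strict_mono) auto
  then have "1 < (real n + 1) * u ^ n" unfolding peak_power[OF n] by (simp add: field_simps)
  then show "\<exists>d. (spread n has_real_derivative d) (at u) \<and> 0 < d"
    using spread_has_derivative[OF n] n by (intro exI conjI) auto
next
  show "continuous_on {x..y} (spread n)"
    using spread_has_derivative[OF n] by (intro DERIV_atLeastAtMost_imp_continuous_on) blast
qed

lemma spread_peak: assumes "n > 0" shows "spread n (peak n) = 1 - peak n"
proof -
  have "(real n + 1) * (peak n * real n / (real n + 1) / n) = peak n"
    using assms by (simp add: divide_simps)
  then show ?thesis unfolding spread_eq[OF assms] gap_peak[OF assms] by simp
qed

lemma spread_1: "spread n 1 = 1" and lead_1: "lead n 1 = 1"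
  by (simp_all add: spread_def lead_def bern_def)

lemma lead_mono:
  assumes n: "n > 0" and "0 \<le> x" "x \<le> y" shows "lead n x \<le> lead n y"
proof (rule DERIV_nonneg_imp_nondecreasing[OF \<open>x \<le> y\<close>])
  fix u assume u: "x \<le> u" "u \<le> y"
  have "0 \<le> (real n + 1) / n * (1 + (real n - 1) * u ^ n)" using u assms by simp
  then show "\<exists>d. (lead n has_real_derivative d) (at u) \<and> 0 \<le> d"
    using lead_has_derivative[OF n] by blast
qed

text \<open>The function \<open>v = - ln (lead n x)\<close> is convex in \<open>u = - ln (spread n x)\<close>, and \<open>v = u = 0\<close> at \<open>x = 1\<close>. Hence
  it is superadditive. Convexity holds since the slope \<open>dv / du\<close> is a product of two factors decreasing
  in \<open>x\<close>, namely \<open>(1 + (n - 1) * x ^ n) / ((n + 1) * x ^ n - 1)\<close> and \<open>spread n x / lead n x\<close>. Superadditivity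
  follows by comparing the increments over \<open>{z..y}\<close> and \<open>{x..1}\<close>, which have the same length in \<open>u\<close>, with
  Cauchy's mean value theorem.\<close>

lemma lead_le_product:
  assumes n: "n > 0"
    and x: "peak n \<le> x" "x \<le> 1" and y: "peak n \<le> y" "y \<le> 1" and z: "peak n \<le> z" "z \<le> 1"
    and lead: "0 \<le> lead n x" "0 \<le> lead n y"
    and spread: "spread n z = spread n x * spread n y"
  shows "lead n z \<le> lead n x * lead n y"
  using x y lead spread
proof (induction x y rule: linorder_wlog)
  case (sym y x)
  then show ?case by (simp add: mult.commute)
next
  case (le y x)
  note hyps = le
  have pk: "0 < peak n" "peak n < 1" using peak_pos[OF n] peak_less_1[OF n] by auto
  have spos: "0 < spread n u" if "peak n \<le> u" for u
    using spread_strict_mono[OF n order_refl, of u] spread_peak[OF n] pk that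
    by (cases "u = peak n") auto
  show ?case
  proof (cases "lead n z \<le> 0 \<or> x = 1")
    case True
    then show ?thesis
    proof
      assume "lead n z \<le> 0"
      then show ?thesis using hyps mult_nonneg_nonneg by (meson order_trans)
    next
      assume "x = 1"
      then have "spread n z = spread n y" using hyps spread_1 by simp
      then have "z = y" using spread_strict_mono[OF n] z hyps by (metis linorder_less_linear less_irrefl)
      then show ?thesis using \<open>x = 1\<close> lead_1 by simp
    qed
  next
    case False
    then have zpos: "0 < lead n z" and x1: "x < 1" using hyps by auto
    have sx: "spread n x < 1" using spread_strict_mono[OF n _ x1] hyps spread_1 by simp
    then have "spread n z < spread n y" using hyps spos[of y] by (simp add: mult_less_cancel_right2)
    then have zy: "z < y" using spread_strict_mono[OF n, of y z] hyps z by (metis linorder_less_linear less_asym)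
    define f where "f = (\<lambda>u. ln (lead n u))"
    define g where "g = (\<lambda>u. ln (spread n u))"
    define f' where "f' = (\<lambda>u. (real n + 1) / n * (1 + (real n - 1) * u ^ n) / lead n u)"
    define g' where "g' = (\<lambda>u. (real n + 1) / n * ((real n + 1) * u ^ n - 1) / spread n u)"
    have lpos: "0 < lead n u" if "z \<le> u" for u
      using lead_mono[OF n _ that] zpos z pk by (smt (verit))
    have df: "(f has_real_derivative f' u) (at u)" if "z \<le> u" for u
      unfolding f_def f'_def using lpos[OF that]
      by (auto intro!: derivative_eq_intros lead_has_derivative[OF n])
    have dg: "(g has_real_derivative g' u) (at u)" if "z \<le> u" for u
      unfolding g_def g'_def using spos[of u] that z
      by (auto intro!: derivative_eq_intros spread_has_derivative[OF n])
    have cont: "isCont f u" "isCont g u" if "z \<le> u" for u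
      using df[OF that] dg[OF that] DERIV_isCont by blast+
    have gmvt: "\<exists>c>a. c < b \<and> (f b - f a) * g' c = (g b - g a) * f' c" if "z \<le> a" "a < b" for a b
      by (rule GMVT'[OF \<open>a < b\<close>]) (use df dg cont that in auto)
    obtain \<xi> where \<xi>: "z < \<xi>" "\<xi> < y" "(f y - f z) * g' \<xi> = (g y - g z) * f' \<xi>"
      using gmvt[of z y] zy by auto
    obtain \<zeta> where \<zeta>: "x < \<zeta>" "\<zeta> < 1" "(f 1 - f x) * g' \<zeta> = (g 1 - g x) * f' \<zeta>"
      using gmvt[of x 1] x1 zy hyps by auto
    have gt1: "1 < (real n + 1) * u ^ n" if "z < u" for u
    proof -
      have "peak n ^ n < u ^ n" using that z pk n by (intro power_strict_mono) auto
      then show ?thesis unfolding peak_power[OF n] by (simp add: field_simps)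
    qed
    have g'pos: "0 < g' u" if "z < u" for u
    proof -
      show ?thesis unfolding g'_def using gt1[OF that] spos[of u] that z n by simp
    qed
    \<comment> \<open>the slope \<open>f' / g'\<close> decreases from \<open>\<xi>\<close> to \<open>\<zeta>\<close>\<close>
    have ratio: "f' \<zeta> * g' \<xi> \<le> f' \<xi> * g' \<zeta>"
    proof -
      have le: "\<xi> \<le> \<zeta>" "0 \<le> \<xi>" using \<xi> \<zeta> hyps z pk by auto
      have pw: "\<xi> ^ n \<le> \<zeta> ^ n" and pw': "\<xi> ^ Suc n \<le> \<zeta> ^ Suc n"
        using le by (intro power_mono; simp)+
      have b: "bern n \<zeta> \<le> bern n \<xi>" using bern_antimono le \<zeta> by auto
      have "bern n \<zeta> * \<xi> ^ Suc n \<le> bern n \<xi> * \<zeta> ^ Suc n"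
        using b pw' bern_nonneg le by (intro mult_mono) auto
      then have "bern n \<zeta> / n * \<xi> ^ Suc n \<le> bern n \<xi> / n * \<zeta> ^ Suc n"
        using n by (simp add: field_simps)
      moreover have "(a + b) * (c - d) \<le> (c + d) * (a - b)" if "b * c \<le> d * a" for a b c d :: real
        using that by (simp add: algebra_simps)
      ultimately have ED: "spread n \<zeta> * lead n \<xi> \<le> spread n \<xi> * lead n \<zeta>"
        unfolding spread_def lead_def by blast
      have pos: "0 < spread n \<xi>" "0 < spread n \<zeta>" "0 < lead n \<xi>" "0 < lead n \<zeta>"
        using spos lpos \<xi> \<zeta> hyps z zy by auto
      have yy: "(1 + (real n - 1) * \<zeta> ^ n) * ((real n + 1) * \<xi> ^ n - 1)
         \<le> (1 + (real n - 1) * \<xi> ^ n) * ((real n + 1) * \<zeta> ^ n - 1)"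
        using mult_left_mono[OF pw, of "2 * real n"] by (simp add: algebra_simps)
      have y0: "0 \<le> (1 + (real n - 1) * \<zeta> ^ n) * ((real n + 1) * \<xi> ^ n - 1)"
      proof (intro mult_nonneg_nonneg)
        show "0 \<le> 1 + (real n - 1) * \<zeta> ^ n" using n le by simp
        show "0 \<le> (real n + 1) * \<xi> ^ n - 1" using gt1[OF \<xi>(1)] by simp
      qed
      have "((1 + (real n - 1) * \<zeta> ^ n) * ((real n + 1) * \<xi> ^ n - 1)) * (spread n \<zeta> * lead n \<xi>)
        \<le> ((1 + (real n - 1) * \<xi> ^ n) * ((real n + 1) * \<zeta> ^ n - 1)) * (spread n \<xi> * lead n \<zeta>)"
        by (rule mult_mono[OF yy ED order_trans[OF y0 yy]]) (use pos in auto)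
      then have main: "(1 + (real n - 1) * \<zeta> ^ n) / lead n \<zeta> * (((real n + 1) * \<xi> ^ n - 1) / spread n \<xi>)
        \<le> (1 + (real n - 1) * \<xi> ^ n) / lead n \<xi> * (((real n + 1) * \<zeta> ^ n - 1) / spread n \<zeta>)"
        using pos by (simp add: divide_simps) (simp add: mult_ac)
      have "((real n + 1) / n)\<^sup>2 * ((1 + (real n - 1) * \<zeta> ^ n) / lead n \<zeta> * (((real n + 1) * \<xi> ^ n - 1) / spread n \<xi>))
        \<le> ((real n + 1) / n)\<^sup>2 * ((1 + (real n - 1) * \<xi> ^ n) / lead n \<xi> * (((real n + 1) * \<zeta> ^ n - 1) / spread n \<zeta>))"
        using main by (intro mult_left_mono) auto
      then show ?thesis unfolding f'_def g'_def by (simp add: power2_eq_square mult_ac)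
    qed
    define G where "G = - g x"
    have g1: "g 1 = 0" "f 1 = 0" by (simp_all add: g_def f_def spread_1 lead_1)
    have Gyz: "g y - g z = G"
      unfolding G_def g_def hyps(8) using spos[of x] spos[of y] hyps by (simp add: ln_mult)
    have G0: "0 \<le> G" unfolding G_def g_def using sx spos[of x] hyps by simp
    have gp: "0 < g' \<xi>" "0 < g' \<zeta>" using g'pos \<xi> \<zeta> hyps zy by auto
    have e1: "f y - f z = G * (f' \<xi> / g' \<xi>)" using \<xi>(3) gp unfolding Gyz by (simp add: field_simps)
    have e2: "- f x = G * (f' \<zeta> / g' \<zeta>)" using \<zeta>(3) gp unfolding g1 G_def by (simp add: field_simps)
    have "f' \<zeta> / g' \<zeta> \<le> f' \<xi> / g' \<xi>" using ratio gp by (simp add: divide_simps mult_ac)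
    then have "- f x \<le> f y - f z" unfolding e1 e2 using G0 by (intro mult_left_mono)
    then have "ln (lead n z) \<le> ln (lead n y * lead n x)"
      unfolding f_def using lpos[of x] lpos[of y] hyps zy by (simp add: ln_mult)
    then show ?thesis using lpos[of x] lpos[of y] lpos[of z] hyps zy by (simp add: mult.commute)
  qed
qed

text \<open>On \<open>{0..1 - peak n}\<close> the function \<open>psi\<close> increases, so an upper bound for the second atom may replace it.\<close>

lemma psi_le_of_le:
  assumes n: "n > 0" and "s \<le> M" "M \<le> 1 - peak n" "psi (Suc n) M \<le> m" and "s \<le> 1"
  shows "psi (Suc n) s \<le> m"
proof -
  have "gap n (1 - s) \<le> gap n (1 - M)" using assms by (intro gap_antimono) auto
  then have "psi (Suc n) s \<le> psi (Suc n) M" unfolding psi_eq_gap by (simp add: divide_right_mono)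
  then show ?thesis using assms by simp
qed

lemma psi_le_of_peak:
  assumes n: "n > 0" and "gap n (peak n) / n \<le> m" and "s \<le> 1"
  shows "psi (Suc n) s \<le> m"
proof -
  have "gap n (1 - s) \<le> gap n (peak n)" using assms by (intro gap_le_peak) auto
  then have "psi (Suc n) s \<le> gap n (peak n) / n" unfolding psi_eq_gap by (simp add: divide_right_mono)
  then show ?thesis using assms by simp
qed

text \<open>Here \<open>m\<close> and \<open>M\<close> are the bounds for the atoms of a quasigroup convolution, given through the coordinates
  that multiply. Either \<open>m\<close> already dominates the maximum of \<open>psi\<close>, or \<open>m = psi (Suc n) (1 - z)\<close> for some
  \<open>z \<ge> peak n\<close>, and then comparing \<open>lead\<close> at \<open>z\<close> with the product gives \<open>M \<le> 1 - z\<close>.\<close>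

lemma quasigroup_psi_bound:
  assumes n: "n > 0"
    and x: "peak n \<le> x" "x \<le> 1" and y: "peak n \<le> y" "y \<le> 1"
    and lead: "0 \<le> lead n x" "0 \<le> lead n y"
    and m: "spread n x * spread n y = 1 - (real n + 1) * m"
    and M: "lead n x * lead n y = 1 - 2 * M - (real n - 1) * m"
    and s: "s \<le> M" "s \<le> 1"
  shows "psi (Suc n) s \<le> m"
proof (cases "spread n x * spread n y < 1 - peak n")
  case True
  then have "peak n / (real n + 1) \<le> m" unfolding m using n by (simp add: field_simps)
  then have "gap n (peak n) / n \<le> m" unfolding gap_peak[OF n] using n by simp
  then show ?thesis using psi_le_of_peak n s by blast
next
  case False
  have pk: "0 < peak n" "peak n < 1" using peak_pos[OF n] peak_less_1[OF n] by auto
  have s1: "0 \<le> spread n u" "spread n u \<le> 1" if "peak n \<le> u" "u \<le> 1" for u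
    using spread_strict_mono[OF n order_refl, of u] spread_peak[OF n] pk that
      spread_strict_mono[OF n, of u 1] spread_1[of n]
    by (cases "u = peak n"; cases "u = 1"; simp)+
  have "\<exists>z\<ge>peak n. z \<le> 1 \<and> spread n z = spread n x * spread n y"
  proof (rule IVT)
    show "spread n (peak n) \<le> spread n x * spread n y" using False spread_peak[OF n] by simp
    show "spread n x * spread n y \<le> spread n 1"
      using s1[OF x] s1[OF y] spread_1 by (simp add: mult_le_one)
    show "peak n \<le> 1" using pk by simp
    show "\<forall>x. peak n \<le> x \<and> x \<le> 1 \<longrightarrow> isCont (spread n) x"
      using DERIV_isCont spread_has_derivative[OF n] by blast
  qed
  then obtain z where z: "peak n \<le> z" "z \<le> 1" "spread n z = spread n x * spread n y" by blast
  have "lead n z \<le> lead n x * lead n y" by (rule lead_le_product[OF n x y z(1,2) lead z(3)])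
  moreover have mz: "m = gap n z / n"
  proof -
    have "(real n + 1) * (gap n z / n) = (real n + 1) * m"
      using spread_eq[OF n, of z] z(3) m by linarith
    then show ?thesis by (subst (asm) mult_left_cancel) auto
  qed
  ultimately have "2 * z - 1 - (real n - 1) * m \<le> 1 - 2 * M - (real n - 1) * m"
    unfolding M lead_eq[OF n, of z] by simp
  then have "M \<le> 1 - z" by simp
  then show ?thesis
    using psi_le_of_le[OF n, of s "1 - z" m] z s mz by (simp add: psi_eq_gap)
qed

section \<open>One largest atom at the absorbing zero\<close>

text \<open>The polynomial \<open>\<Sum>j<n. (n - j) * x ^ j\<close>, which is the quotient of \<open>bern n x\<close> by \<open>(1 - x)\<^sup>2\<close>. The
  recursion makes this and its monotonicity immediate.\<close>

fun tri :: "nat \<Rightarrow> real \<Rightarrow> real" where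
  "tri 0 x = 0"
| "tri (Suc n) x = tri n x + (\<Sum>i\<le>n. x ^ i)"

lemma bern_eq_tri: "bern n x = (1 - x)\<^sup>2 * tri n x"
proof (induction n)
  case 0 then show ?case by (simp add: bern_def)
next
  case (Suc n)
  have "(1 - x)\<^sup>2 * (\<Sum>i\<le>n. x ^ i) = (1 - x) * (1 - x ^ Suc n)"
    using sum_gp_basic[of x n] by (simp add: power2_eq_square)
  then show ?case using Suc by (simp add: distrib_left) (simp add: bern_def algebra_simps)
qed

lemma tri_mono: "0 \<le> x \<Longrightarrow> x \<le> y \<Longrightarrow> tri n x \<le> tri n y"
  by (induction n) (auto intro!: add_mono sum_mono power_mono)

lemma tri_nonneg: "0 \<le> x \<Longrightarrow> 0 \<le> tri n x"
  by (induction n) (auto intro!: add_nonneg_nonneg sum_nonneg)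

text \<open>For large \<open>n\<close> the right-hand side is close to \<open>exp (- 2)\<close>, while the left-hand side tends to \<open>0\<close>. The
  value \<open>2 / (2 * n + 5)\<close> is chosen so that the polynomial inequality needed at the end of
  \<open>bern_reciprocal_le\<close> holds for it with almost no loss, for all \<open>n\<close> at once.\<close>

lemma critical_root_bound:
  fixes n :: nat assumes "n \<ge> 3"
  shows "2 / (2 * real n + 5) \<le> ((2 * (real n)\<^sup>2 + 3 * real n + 2) / ((2 * real n + 5) * (real n + 1))) ^ Suc n"
proof (cases "n < 10")
  case True
  then have "n \<in> {3, 4, 5, 6, 7, 8, 9}" using assms by auto
  then show ?thesis by (auto simp: power_divide divide_simps eval_nat_numeral)
next
  case False
  define N where "N = real n"
  have N: "N \<ge> 10" using False by (simp add: N_def)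
  \<comment> \<open>\<open>5/2\<close> is an upper bound for \<open>2 * (N + 1) / (N - 1)\<close>, and \<open>25/2\<close> is the value of \<open>(2 * N + 5) / 2\<close> at \<open>10\<close>\<close>
  have "exp (5/2 :: real) ^ 2 = exp 1 ^ 5" by (simp flip: exp_of_nat_mult)
  also have "\<dots> \<le> (272 / 100) ^ 5" using e_less_272 by (intro power_mono) auto
  also have "\<dots> \<le> (25 / 2)\<^sup>2" by (simp add: power_divide)
  finally have e: "exp (5/2 :: real) \<le> 25 / 2" by (rule power2_le_imp_le) simp
  have "((N + 1) / (N - 1)) ^ Suc n \<le> exp (2 / (N - 1)) ^ Suc n"
  proof (rule power_mono)
    have "(N + 1) / (N - 1) = 1 + 2 / (N - 1)" using N by (simp add: field_simps)
    then show "(N + 1) / (N - 1) \<le> exp (2 / (N - 1))" using exp_ge_add_one_self by metis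
  qed (use N in auto)
  also have "\<dots> = exp ((N + 1) * (2 / (N - 1)))"
    unfolding exp_of_nat_mult[symmetric] N_def by (simp add: add.commute)
  also have "\<dots> \<le> exp (5 / 2)" using N by (simp add: field_simps)
  also have "\<dots> \<le> 25 / 2" by (rule e)
  also have "\<dots> \<le> (2 * N + 5) / 2" using N by simp
  finally have "2 / (2 * N + 5) \<le> 1 / ((N + 1) / (N - 1)) ^ Suc n"
    using N by (simp add: field_simps del: power_Suc)
  also have "\<dots> = ((N - 1) / (N + 1)) ^ Suc n" by (simp add: power_divide)
  also have "\<dots> \<le> ((2 * N\<^sup>2 + 3 * N + 2) / ((2 * N + 5) * (N + 1))) ^ Suc n"
  proof (rule power_mono)
    have "(N - 1) / (N + 1) = ((2 * N + 5) * (N - 1)) / ((2 * N + 5) * (N + 1))" using N by simp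
    also have "\<dots> \<le> (2 * N\<^sup>2 + 3 * N + 2) / ((2 * N + 5) * (N + 1))"
      using N by (intro divide_right_mono) (auto simp: algebra_simps power2_eq_square)
    finally show "(N - 1) / (N + 1) \<le> (2 * N\<^sup>2 + 3 * N + 2) / ((2 * N + 5) * (N + 1))" .
  qed (use N in auto)
  finally show ?thesis unfolding N_def .
qed

lemma power_ge_of_lead_nonneg:
  assumes n: "n \<ge> 3" and x: "0 \<le> x" and D: "real n \<le> (real n + 1) * x + (real n - 1) * x ^ Suc n"
  shows "2 / (2 * real n + 5) \<le> x ^ Suc n"
proof (rule ccontr)
  define N where "N = real n"
  define z where "z = (2 * N\<^sup>2 + 3 * N + 2) / ((2 * N + 5) * (N + 1))"
  have N: "N \<ge> 3" using n by (simp add: N_def)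
  assume neg: "\<not> 2 / (2 * real n + 5) \<le> x ^ Suc n"
  then have "x ^ Suc n \<le> 2 / (2 * N + 5)" by (simp add: N_def)
  then have "(N - 1) * x ^ Suc n \<le> (N - 1) * (2 / (2 * N + 5))" using N by (intro mult_left_mono) auto
  then have "N - (N - 1) * (2 / (2 * N + 5)) \<le> (N + 1) * x" using D by (simp add: N_def)
  moreover have "N - (N - 1) * (2 / (2 * N + 5)) = (N + 1) * z"
  proof -
    have "(N + 1) * z = (2 * N\<^sup>2 + 3 * N + 2) / (2 * N + 5)" unfolding z_def using N by simp
    then show ?thesis using N by (simp add: field_simps power2_eq_square)
  qed
  ultimately have "z \<le> x" using N by simp
  moreover have "0 \<le> z" unfolding z_def using N by simp
  ultimately have "z ^ Suc n \<le> x ^ Suc n" by (intro power_mono)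
  then show False using critical_root_bound[OF n] neg unfolding z_def N_def by linarith
qed

text \<open>Divided by \<open>(1 - x)\<^sup>2\<close>, the right-hand side increases with \<open>x\<close> and the left-hand side decreases.
  So it suffices to check the smallest admissible \<open>x\<close>, called \<open>a\<close> below, where \<open>a ^ Suc n\<close> is rational.\<close>

lemma bern_reciprocal_le:
  assumes n: "n \<ge> 3" and x: "0 \<le> x" "x \<le> 1" "2 / (2 * real n + 5) \<le> x ^ Suc n"
  shows "x * bern n (1 / x) \<le> n * bern n x"
proof -
  define N where "N = real n"
  define c where "c = 2 / (2 * N + 5)"
  define a where "a = root (Suc n) c"
  define z where "z = (2 * N\<^sup>2 + 3 * N + 2) / ((2 * N + 5) * (N + 1))"
  have N: "N \<ge> 3" using n by (simp add: N_def)
  have c: "0 < c" "c < 1" using N by (auto simp: c_def)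
  have a: "0 < a" "a ^ Suc n = c" "a < 1"
    using c unfolding a_def by (auto simp del: power_Suc)
  have ax: "a \<le> x"
    by (rule power_le_imp_le_base[of _ n]) (use a x c_def N_def in \<open>auto simp del: power_Suc\<close>)
  have xp: "0 < x" using a ax by linarith
  have scale: "bern n u = (1 - u)\<^sup>2 * tri n u" "u * bern n (1 / u) = (1 - u)\<^sup>2 * (tri n (1 / u) / u)"
    if "0 < u" for u
    using that by (auto simp: bern_eq_tri field_simps power2_eq_square)
  \<comment> \<open>the inequality at \<open>a\<close> is linear in \<open>a\<close> once \<open>a ^ Suc n = c\<close> is used; \<open>a\<close> may then be replaced by \<open>z\<close>\<close>
  have "a \<le> z"
    by (rule power_le_imp_le_base[of _ n])
      (use a N critical_root_bound[OF n] in \<open>auto simp: z_def c_def N_def simp del: power_Suc\<close>)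
  have "a * bern n (1 / a) = N * a - (N + 1) + a / c"
    using a by (simp add: bern_def N_def power_divide algebra_simps flip: a(2))
  also have "\<dots> = a * (N + (2 * N + 5) / 2) - (N + 1)" by (simp add: c_def algebra_simps)
  also have "\<dots> \<le> N * (N - (N + 1) * a + c)"
  proof -
    have "a * (N\<^sup>2 + 3 * N + 5 / 2) \<le> z * (N\<^sup>2 + 3 * N + 5 / 2)"
      using \<open>a \<le> z\<close> N by (intro mult_right_mono) auto
    also have "\<dots> \<le> N\<^sup>2 + N + 1 + N * c"
    proof -
      have "(2 * N\<^sup>2 + 3 * N + 2) * (N\<^sup>2 + 3 * N + 5 / 2) / (N + 1) \<le> (N\<^sup>2 + N + 1) * (2 * N + 5) + 2 * N"
        using N by (simp add: pos_divide_le_eq) (simp add: algebra_simps power2_eq_square)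
      then have "(2 * N\<^sup>2 + 3 * N + 2) * (N\<^sup>2 + 3 * N + 5 / 2) / (N + 1) / (2 * N + 5)
          \<le> ((N\<^sup>2 + N + 1) * (2 * N + 5) + 2 * N) / (2 * N + 5)"
        using N by (intro divide_right_mono) auto
      also have "\<dots> = N\<^sup>2 + N + 1 + N * c"
        unfolding c_def using N by (simp add: add_divide_distrib)
      finally show ?thesis unfolding z_def using N by (simp add: mult.commute)
    qed
    finally show ?thesis by (simp add: algebra_simps power2_eq_square add_divide_distrib)
  qed
  also have "\<dots> = N * bern n a" unfolding bern_def a(2) N_def by simp
  finally have "(1 - a)\<^sup>2 * (tri n (1 / a) / a) \<le> (1 - a)\<^sup>2 * (N * tri n a)"
    unfolding scale[OF a(1)] by (simp add: mult_ac)
  then have "tri n (1 / a) / a \<le> N * tri n a"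
    using a(3) by (subst (asm) mult_le_cancel_left_pos) auto
  moreover have "tri n (1 / x) / x \<le> tri n (1 / a) / a"
    using a ax xp by (intro frac_le tri_mono tri_nonneg) (auto simp: field_simps)
  moreover have "N * tri n a \<le> N * tri n x"
    using tri_mono[of a x n] a ax N by (intro mult_left_mono) auto
  ultimately have "tri n (1 / x) / x \<le> N * tri n x" by linarith
  then have "(1 - x)\<^sup>2 * (tri n (1 / x) / x) \<le> (1 - x)\<^sup>2 * (N * tri n x)" by (intro mult_left_mono) auto
  then show ?thesis unfolding scale[OF xp] N_def by (simp add: mult_ac)
qed

text \<open>The derivative of \<open>bern n u / (1 - u ^ Suc n) ^ Suc n\<close> is, up to a positive factor,
  \<open>n * bern n u - u * bern n (1 / u)\<close>. In terms of \<open>s = 1 - u ^ Suc n\<close> the statement says that \<open>bern\<close> as a function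
  of \<open>s\<close> shrinks at most like \<open>s ^ Suc n\<close>.\<close>

lemma bern_quotient_mono:
  assumes n: "n \<ge> 3" and x: "0 \<le> x" "x \<le> y" "y < 1" "2 / (2 * real n + 5) \<le> x ^ Suc n"
  shows "bern n x * (1 - y ^ Suc n) ^ Suc n \<le> bern n y * (1 - x ^ Suc n) ^ Suc n"
proof -
  define k where "k = Suc n"
  define h where "h = (\<lambda>u::real. 1 - u ^ k)"
  have xp: "0 < x" using x(4) n by (cases "x = 0") (use x in auto)
  have hpos: "0 < h u" if "0 \<le> u" "u < 1" for u
    unfolding h_def using that power_Suc_less_one[of u n] by (cases "u = 0") (auto simp: k_def)
  have "bern n x / h x ^ k \<le> bern n y / h y ^ k"
  proof (rule DERIV_nonneg_imp_nondecreasing[OF x(2)])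
    fix u assume u: "x \<le> u" "u \<le> y"
    have u': "0 < u" "u < 1" using u xp x by auto
    have hp: "0 < h u" using hpos u' by simp
    have dh: "(h has_real_derivative - (real k * u ^ n)) (at u)"
      unfolding h_def k_def by (auto intro!: derivative_eq_intros simp del: power_Suc)
    have d: "((\<lambda>u. bern n u / h u ^ k) has_real_derivative
        ((real n + 1) * (u ^ n - 1) * h u ^ k - bern n u * (real k * (- (real k * u ^ n) * h u ^ (k - 1)))) / (h u ^ k * h u ^ k)) (at u)"
      using hp by (auto intro!: derivative_eq_intros bern_has_derivative dh)
    have "u ^ k \<ge> x ^ k" using u x by (intro power_mono) auto
    then have rec: "u * bern n (1 / u) \<le> n * bern n u"
      using bern_reciprocal_le[OF n, of u] u' x unfolding k_def by linarith
    have "0 \<le> u ^ n * (n * bern n u - u * bern n (1 / u))" using rec u' by simp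
    also have "\<dots> = real k * u ^ n * bern n u - (1 - u ^ n) * h u"
      unfolding bern_def h_def k_def using u' by (simp add: power_divide field_simps)
    finally have "0 \<le> real k * h u ^ (k - 1) * (real k * u ^ n * bern n u - (1 - u ^ n) * h u)"
      using hp by simp
    also have "\<dots> = (real n + 1) * (u ^ n - 1) * h u ^ k - bern n u * (real k * (- (real k * u ^ n) * h u ^ (k - 1)))"
      unfolding k_def by (simp add: algebra_simps)
    finally have "0 \<le> ((real n + 1) * (u ^ n - 1) * h u ^ k - bern n u * (real k * (- (real k * u ^ n) * h u ^ (k - 1)))) / (h u ^ k * h u ^ k)"
      using hp by (intro divide_nonneg_pos) auto
    then show "\<exists>d. ((\<lambda>u. bern n u / h u ^ k) has_real_derivative d) (at u) \<and> 0 \<le> d"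
      using d by blast
  qed
  then show ?thesis using hpos[of x] hpos[of y] x xp unfolding h_def k_def
    by (simp add: field_simps del: power_Suc)
qed

text \<open>The first law has its largest atom at the zero and second atom \<open>1 - x\<close>; the second law has mass \<open>T\<close> off the
  zero, all its atoms are at least \<open>l\<close>, and \<open>R\<close> is its excess off the zero. A point \<open>X\<close> is defined by scaling
  \<open>1 - x ^ Suc n\<close> with \<open>T\<close>. By \<open>bern_quotient_mono\<close> the new excess \<open>b * R \<le> b * T ^ Suc n\<close> is then admissible for
  the second atom \<open>1 - X\<close>. It is also admissible for \<open>M\<close>: if \<open>M\<close> exceeds \<open>1 - X\<close>, this is monotonicity of
  \<open>bern\<close>; otherwise the excess of the convolution off its second atom is still at most \<open>X ^ Suc n\<close>.\<close>

lemma one_zero_peak_bound: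
  fixes x T l R :: real
  assumes n: "n \<ge> 3" and x: "0 \<le> x" "x \<le> 1"
    and D: "real n \<le> (real n + 1) * x + (real n - 1) * x ^ Suc n"
    and T: "0 \<le> T" "T \<le> 1" and l: "0 \<le> l" and R: "0 \<le> R" "R = T - n * l" "R \<le> T ^ Suc n"
  defines "m \<equiv> gap n x / n" and "b \<equiv> bern n x / n"
  defines "M \<equiv> m * T + l * b + b * R"
  shows "n * (b * R) \<le> bern n (1 - M)"
proof -
  have n0: "real n > 0" using n by simp
  define c where "c = x ^ Suc n"
  have c: "0 \<le> c" "c \<le> 1" unfolding c_def using x by (auto intro: power_le_one simp del: power_Suc)
  have b0: "0 \<le> b" unfolding b_def using bern_nonneg[OF x(1)] by simp
  have m0: "0 \<le> m" unfolding m_def using gap_nonneg[OF x] by simp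
  have mb: "m + b = 1 - x" unfolding m_def b_def gap_def bern_def using n0 by (simp add: field_simps)
  have km: "(real n + 1) * m = 1 - c - b"
    unfolding m_def b_def gap_def bern_def c_def using n0 by (simp add: field_simps)
  define X where "X = root (Suc n) (1 - T * (1 - c))"
  have Tc: "0 \<le> T * (1 - c)" "T * (1 - c) \<le> 1 - c" using T c by (auto intro: mult_left_le_one_le)
  have Xk: "X ^ Suc n = 1 - T * (1 - c)" and X0: "0 \<le> X"
    unfolding X_def using Tc c by (auto simp del: power_Suc)
  have X1: "X \<le> 1"
    by (rule power_le_imp_le_base[of _ n]) (use Xk Tc in \<open>auto simp del: power_Suc\<close>)
  have xX: "x \<le> X"
    by (rule power_le_imp_le_base[of _ n]) (use Xk X0 Tc c_def in \<open>auto simp del: power_Suc\<close>)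
  have elast: "bern n x * T ^ Suc n \<le> bern n X"
  proof (cases "X = 1 \<or> T = 0")
    case True
    then have "T = 0 \<or> x = 1"
    proof
      assume "X = 1"
      then have "T = 0 \<or> c = 1" using Xk by simp
      moreover have "x = 1" if "c = 1"
        using power_inject_base[of x n 1] that x unfolding c_def by simp
      ultimately show ?thesis by blast
    qed simp
    then show ?thesis using bern_nonneg[OF X0] by (auto simp: bern_def)
  next
    case False
    then have X: "X < 1" using X1 by simp
    then have "c < 1" unfolding c_def using xX x power_Suc_less_one[of x n]
      by (cases "x = 0") auto
    have "bern n x * (T * (1 - c)) ^ Suc n \<le> bern n X * (1 - c) ^ Suc n"
      using bern_quotient_mono[OF n x(1) xX X power_ge_of_lead_nonneg[OF n x(1) D]]
      unfolding Xk c_def by (simp del: power_Suc)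
    then have "(bern n x * T ^ Suc n) * (1 - c) ^ Suc n \<le> bern n X * (1 - c) ^ Suc n"
      by (simp add: power_mult_distrib mult_ac)
    then show ?thesis using \<open>c < 1\<close> by (simp del: power_Suc)
  qed
  have "n * (b * R) = bern n x * R" unfolding b_def using n0 by simp
  also have "\<dots> \<le> bern n x * T ^ Suc n" using R bern_nonneg[OF x(1)] by (intro mult_left_mono) auto
  also have "\<dots> \<le> bern n X" by (rule elast)
  finally have bX: "n * (b * R) \<le> bern n X" .
  have M0: "0 \<le> M" unfolding M_def using m0 b0 T l R by simp
  have M1: "M \<le> 1"
  proof -
    have "M = m * T + b * (l + R)" unfolding M_def by (simp add: algebra_simps)
    also have "\<dots> \<le> m * T + b * T"
    proof -
      have "l \<le> n * l" using n l by (simp add: mult_le_cancel_right1)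
      then have "l + R \<le> T" using R by simp
      then show ?thesis using b0 by (intro add_left_mono mult_left_mono)
    qed
    also have "\<dots> = (1 - x) * T" by (simp add: mb[symmetric] algebra_simps)
    also have "\<dots> \<le> 1" using x T by (intro mult_le_one) auto
    finally show ?thesis .
  qed
  have split: "(real n + 1) * M - n * (b * R) = 1 - X ^ Suc n + l * b"
  proof -
    have "(real n + 1) * M - n * (b * R) = ((real n + 1) * m) * T + (real n + 1) * (l * b) + b * R"
      unfolding M_def by (simp add: algebra_simps)
    then show ?thesis unfolding km Xk R(2) by (simp add: algebra_simps)
  qed
  show ?thesis
  proof (cases "X \<le> 1 - M")
    case True
    then have "X ^ Suc n \<le> (1 - M) ^ Suc n" using X0 by (intro power_mono)
    then have "n * (b * R) \<le> (real n + 1) * M - 1 + (1 - M) ^ Suc n"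
      using split mult_nonneg_nonneg[OF l b0] by linarith
    then show ?thesis by (simp add: bern_def algebra_simps)
  next
    case False
    then have "bern n X \<le> bern n (1 - M)" using bern_antimono[of "1 - M" X n] X1 M1 by simp
    then show ?thesis using bX by linarith
  qed
qed

section \<open>Both largest atoms at the absorbing zero\<close>

text \<open>After multiplication by \<open>\<kappa> * (1 - \<kappa>) * (1 + \<kappa>)\<close> the left-hand side is \<open>P * Z\<close> with \<open>P = \<rho> * (1 - \<kappa>\<^sup>2)\<close> and
  \<open>Z = N * \<kappa>\<^sup>2 + \<kappa>\<close>, to be compared with the square of \<open>L = P + N * \<kappa>\<^sup>2\<close>. For \<open>\<kappa> \<le> 1 / 2\<close> the last hypothesis
  bounds the share of \<open>P\<close> in \<open>P + Z\<close> by \<open>\<kappa>\<close>, so that \<open>P * Z \<le> \<kappa> * (1 - \<kappa>) * (P + Z)\<^sup>2\<close>. For \<open>\<kappa> \<ge> 5 / 8\<close> one uses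
  \<open>P \<le> (1 - \<kappa>\<^sup>2) * L\<close>. In between \<open>P * Z \<le> (P + Z)\<^sup>2 / 4\<close> is enough.\<close>

lemma two_zero_peaks_polynomial_ineq:
  fixes \<rho> \<kappa> N :: real
  assumes N: "N \<ge> 3" and r: "1 \<le> \<rho>" "\<rho> \<le> N" and k: "0 < \<kappa>" "\<kappa> \<le> 1"
    and C: "\<rho> * (1 - \<kappa>)\<^sup>2 * (1 + \<kappa>) \<le> \<kappa>\<^sup>2 * (1 + N * \<kappa>)"
  shows "\<rho> * (1 + N * \<kappa>) \<le> (1 + \<kappa>) * (\<rho> + (N - \<rho>) * \<kappa>\<^sup>2)\<^sup>2"
proof (cases "\<kappa> = 1")
  case True
  have "\<rho> * (1 + N) \<le> N * (1 + N)" using r N by (intro mult_right_mono) auto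
  also have "\<dots> \<le> 2 * N\<^sup>2" using N by (simp add: power2_eq_square algebra_simps)
  finally show ?thesis using True by simp
next
  case False
  then have k1: "\<kappa> < 1" using k by simp
  define P where "P = \<rho> * (1 - \<kappa>\<^sup>2)"
  define X where "X = N * \<kappa>\<^sup>2"
  define L where "L = P + X"
  have L: "\<rho> + (N - \<rho>) * \<kappa>\<^sup>2 = L" unfolding L_def P_def X_def by (simp add: algebra_simps)
  have k2: "0 \<le> 1 - \<kappa>\<^sup>2" using k by (simp add: power_le_one)
  have P1: "1 - \<kappa>\<^sup>2 \<le> P" unfolding P_def using r k2 by (simp add: mult_le_cancel_right1)
  have X0: "0 \<le> X" unfolding X_def using N by simp
  have Lr: "\<rho> \<le> L" unfolding L[symmetric] using r by simp
  then have L1: "1 \<le> L" using r by linarith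
  have main: "P * (X + \<kappa>) \<le> \<kappa> * (1 - \<kappa>) * ((1 + \<kappa>) * L)\<^sup>2"
  proof (cases "5 / 8 \<le> \<kappa>")
    case True
    have "P \<le> (1 - \<kappa>\<^sup>2) * L" unfolding P_def using Lr k2 by (simp add: mult.commute mult_right_mono)
    moreover have "X + \<kappa> \<le> \<kappa> * (1 + \<kappa>) * L"
    proof -
      have "25 / 64 \<le> \<kappa>\<^sup>2" using power_mono[OF True, of 2] by (simp add: power_divide)
      then have "\<kappa> + \<kappa>\<^sup>2 - 1 \<le> (\<kappa> + \<kappa>\<^sup>2 - 1) * L" using True L1 by (simp add: mult_le_cancel_left1)
      then have "\<kappa> + L \<le> P + (\<kappa> + \<kappa>\<^sup>2) * L" using P1 by (simp add: algebra_simps)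
      then show ?thesis unfolding L_def by (simp add: algebra_simps power2_eq_square)
    qed
    ultimately have "P * (X + \<kappa>) \<le> ((1 - \<kappa>\<^sup>2) * L) * (\<kappa> * (1 + \<kappa>) * L)"
      using P1 k2 X0 k L1 by (intro mult_mono) auto
    also have "\<dots> = \<kappa> * (1 - \<kappa>) * ((1 + \<kappa>) * L)\<^sup>2" by (simp add: power2_eq_square algebra_simps)
    finally show ?thesis .
  next
    case small: False
    show ?thesis
    proof (cases "\<kappa> \<le> 1 / 2")
      case True
      define Z where "Z = X + \<kappa>"
      have Z: "0 < Z" unfolding Z_def using X0 k by linarith
      have "P * (1 - \<kappa>) \<le> \<kappa> * Z"
        using C unfolding P_def Z_def X_def by (simp add: algebra_simps power2_eq_square)
      then have v: "P \<le> \<kappa> * (P + Z)" by (simp add: algebra_simps)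
      have "0 \<le> (\<kappa> * (P + Z) - P) * ((1 - \<kappa>) * (P + Z) - P)"
      proof (rule mult_nonneg_nonneg)
        have "\<kappa> * (P + Z) \<le> (1 - \<kappa>) * (P + Z)" using True P1 k2 Z by (intro mult_right_mono) auto
        then show "0 \<le> (1 - \<kappa>) * (P + Z) - P" using v by simp
      qed (use v in simp)
      then have "P * Z \<le> \<kappa> * (1 - \<kappa>) * (P + Z)\<^sup>2" by (simp add: algebra_simps power2_eq_square)
      also have "\<dots> \<le> \<kappa> * (1 - \<kappa>) * ((1 + \<kappa>) * L)\<^sup>2"
      proof (intro mult_left_mono power_mono)
        have "\<kappa> \<le> \<kappa> * L" using L1 k by simp
        then show "P + Z \<le> (1 + \<kappa>) * L" unfolding Z_def L_def by (simp add: algebra_simps)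
      qed (use P1 k2 Z k in auto)
      finally show ?thesis unfolding Z_def .
    next
      case False
      have "3 / 2 \<le> L"
      proof -
        have "1 / 4 \<le> \<kappa>\<^sup>2" using False power_mono[of "1/2" \<kappa> 2] by (simp add: power_divide)
        then have "3 * (1 / 4) \<le> N * \<kappa>\<^sup>2" using N by (intro mult_mono) auto
        moreover have "\<kappa>\<^sup>2 \<le> 25 / 64" using power_mono[of \<kappa> "5/8" 2] small k by (simp add: power_divide)
        moreover have "3 * \<kappa>\<^sup>2 \<le> N * \<kappa>\<^sup>2" using N by (intro mult_right_mono) auto
        ultimately show ?thesis using P1 \<open>1 / 4 \<le> \<kappa>\<^sup>2\<close> unfolding L_def X_def by linarith
      qed
      then have "\<kappa> \<le> 9 / 20 * L" using small by linarith
      then have s: "P + (X + \<kappa>) \<le> 29 / 20 * L" unfolding L_def by (simp add: algebra_simps)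
      have "4 * (P * (X + \<kappa>)) \<le> (P + (X + \<kappa>))\<^sup>2"
        using zero_le_power2[of "P - (X + \<kappa>)"] by (simp add: power2_eq_square algebra_simps)
      also have "\<dots> \<le> (29 / 20 * L)\<^sup>2" using s P1 k2 X0 k by (intro power_mono) auto
      also have "\<dots> = (841 / 400) * L\<^sup>2" by (simp add: power2_eq_square)
      also have "\<dots> \<le> (4 * (\<kappa> * (1 - \<kappa>)) * (1 + \<kappa>)\<^sup>2) * L\<^sup>2"
      proof (rule mult_right_mono)
        have "0 \<le> (\<kappa> - 3 / 8) * (5 / 8 - \<kappa>)" using False small by (intro mult_nonneg_nonneg) auto
        then have "15 / 16 \<le> 4 * (\<kappa> * (1 - \<kappa>))" by (simp add: algebra_simps)
        moreover have "(3 / 2)\<^sup>2 \<le> (1 + \<kappa>)\<^sup>2" using False by (intro power_mono) auto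
        ultimately have "15 / 16 * (3 / 2)\<^sup>2 \<le> 4 * (\<kappa> * (1 - \<kappa>)) * (1 + \<kappa>)\<^sup>2"
          using k1 k by (intro mult_mono) auto
        then show "841 / 400 \<le> 4 * (\<kappa> * (1 - \<kappa>)) * (1 + \<kappa>)\<^sup>2" by (simp add: power_divide)
      qed simp
      also have "\<dots> = 4 * (\<kappa> * (1 - \<kappa>) * ((1 + \<kappa>) * L)\<^sup>2)"
        by (simp add: power_mult_distrib mult_ac)
      finally show ?thesis by simp
    qed
  qed
  have "(\<kappa> * (1 - \<kappa>) * (1 + \<kappa>)) * (\<rho> * (1 + N * \<kappa>)) = P * (X + \<kappa>)"
    unfolding P_def X_def by (simp add: power2_eq_square algebra_simps)
  also have "\<dots> \<le> \<kappa> * (1 - \<kappa>) * ((1 + \<kappa>) * L)\<^sup>2" by (rule main)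
  also have "\<dots> = (\<kappa> * (1 - \<kappa>) * (1 + \<kappa>)) * ((1 + \<kappa>) * L\<^sup>2)" by (simp add: power2_eq_square mult_ac)
  finally show ?thesis unfolding L using k k1 by (simp add: mult_le_cancel_left_pos)
qed

text \<open>With \<open>q = 1 - t\<close>, the ratio \<open>\<kappa>\<close> is the mean of \<open>q, q\<^sup>2, ..., q ^ n\<close>. Hence \<open>\<kappa>\<^sup>2 \<ge> q ^ Suc n\<close> by the inequality
  between arithmetic and geometric mean, and \<open>q ^ Suc n = 1 - t * (1 + n * \<kappa>)\<close>.\<close>

lemma psi_ratio_square_ge:
  assumes n: "n > 0" and t: "0 < t" "t \<le> 1"
  defines "\<kappa> \<equiv> psi (Suc n) t / t"
  shows "1 - t * (1 + n * \<kappa>) \<le> \<kappa>\<^sup>2"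
proof -
  define q where "q = 1 - t"
  define p where "p = sqrt q"
  have q: "0 \<le> q" using t by (simp add: q_def)
  have p: "0 \<le> p" "p\<^sup>2 = q" using q by (auto simp: p_def)
  obtain j where j: "n = Suc j" using n by (cases n) auto
  have nk: "n * \<kappa> * t = q - q ^ Suc n"
    unfolding \<kappa>_def psi_eq_gap gap_def using t n by (simp add: q_def)
  have "t * (\<Sum>i\<le>j. q ^ i) = 1 - q ^ n"
    using sum_gp_basic[of q j] by (simp add: q_def j)
  then have "q * (t * (\<Sum>i\<le>j. q ^ i)) = q * (1 - q ^ n)" by simp
  moreover have "t * (n * \<kappa>) = q * (1 - q ^ n)" using nk by (simp add: right_diff_distrib mult_ac)
  ultimately have "t * (n * \<kappa>) = t * (q * (\<Sum>i\<le>j. q ^ i))" by (metis mult.left_commute)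
  then have sum: "n * \<kappa> = q * (\<Sum>i\<le>j. q ^ i)" using t by simp
  have "n * p ^ Suc n = q * ((real j + 1) * p ^ j)"
    unfolding p(2)[symmetric] j by (simp add: power2_eq_square)
  also have "\<dots> \<le> n * \<kappa>"
    unfolding sum using sum_even_powers_ge[OF p(1), of j] q unfolding p(2) by (intro mult_left_mono)
  finally have "p ^ Suc n \<le> \<kappa>" using n by simp
  then have "(p ^ Suc n)\<^sup>2 \<le> \<kappa>\<^sup>2" using p by (intro power_mono) auto
  moreover have "(p ^ Suc n)\<^sup>2 = q ^ Suc n"
    unfolding p(2)[symmetric] by (simp only: power_mult[symmetric] mult.commute)
  ultimately show ?thesis using nk by (simp add: q_def algebra_simps)
qed

text \<open>By \<open>bern_eq_tri\<close>, \<open>bern n (1 - t)\<close> is \<open>t\<^sup>2\<close> times a decreasing function of \<open>t\<close>.\<close>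

lemma bern_scale:
  assumes n: "n > 0" and l: "0 \<le> c" "c \<le> 1" and t: "0 \<le> t" "t \<le> 1"
  shows "c\<^sup>2 * bern n (1 - t) \<le> bern n (1 - c * t)"
proof -
  have "0 \<le> 1 - t" "1 - t \<le> 1 - c * t" using l t by (auto simp: mult_left_le_one_le)
  then have "(c * t)\<^sup>2 * tri n (1 - t) \<le> (c * t)\<^sup>2 * tri n (1 - c * t)"
    by (intro mult_left_mono tri_mono) auto
  then show ?thesis unfolding bern_eq_tri by (simp add: power_mult_distrib mult_ac)
qed

text \<open>Here \<open>\<rho>\<close> measures over how many atoms the excess is spread off the zero. In terms of the ratios
  \<open>\<kappa> = m1 / t1\<close> and \<open>\<kappa>' = m2 / t2\<close> the argument of \<open>bern\<close> on the right is \<open>1 - (t1 * L) * t2\<close>, where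
  \<open>L = \<rho> + (n - \<rho>) * \<kappa> * \<kappa>'\<close>. By \<open>bern_scale\<close> it suffices that \<open>\<rho> * b1 \<le> (t1 * L)\<^sup>2\<close>. The bound
  \<open>t1 \<ge> (1 - \<kappa>\<^sup>2) / (1 + n * \<kappa>)\<close> from \<open>psi_ratio_square_ge\<close> reduces this to
  \<open>two_zero_peaks_polynomial_ineq\<close>, and combined with the normalisation of the first law it also gives the
  last hypothesis of that lemma.\<close>

lemma two_zero_peaks_core:
  fixes \<rho> t1 t2 :: real
  assumes n: "n \<ge> 3" and r: "1 \<le> \<rho>" "\<rho> \<le> n"
    and t: "0 < t1" "t1 \<le> 1" "0 < t2" "t2 \<le> 1"
  defines "m1 \<equiv> psi (Suc n) t1" and "m2 \<equiv> psi (Suc n) t2"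
  defines "b1 \<equiv> t1 - m1" and "b2 \<equiv> t2 - m2"
  assumes C: "(\<rho> + 1) * b1 + (real n + 1) * m1 \<le> 1"
    and le: "m1 / t1 \<le> m2 / t2"
  shows "n * (\<rho> * b1 * b2) \<le> bern n (1 - (n * m1 * m2 + \<rho> * (m1 * b2 + m2 * b1) + \<rho> * b1 * b2))"
proof -
  define N where "N = real n"
  have N: "N \<ge> 3" using n by (simp add: N_def)
  define \<kappa> where "\<kappa> = m1 / t1"
  define \<kappa>' where "\<kappa>' = m2 / t2"
  have m: "m1 = \<kappa> * t1" "m2 = \<kappa>' * t2" using t by (auto simp: \<kappa>_def \<kappa>'_def)
  have b: "b1 = (1 - \<kappa>) * t1" "b2 = (1 - \<kappa>') * t2" unfolding b1_def b2_def m by (simp_all add: algebra_simps)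
  have n0: "n > 0" using n by simp
  have bb: "N * b1 = bern n (1 - t1)" "N * b2 = bern n (1 - t2)"
    unfolding b1_def b2_def m1_def m2_def psi_eq_bern[OF n0] N_def using n0 by simp_all
  have "0 \<le> b1" "0 \<le> b2"
    unfolding b1_def b2_def m1_def m2_def using psi_le_self[OF n0] t by auto
  then have k1: "\<kappa> \<le> 1" "\<kappa>' \<le> 1" using t unfolding b by (auto simp: zero_le_mult_iff)
  have "0 \<le> m1" unfolding m1_def using psi_nonneg t by simp
  then have k0: "0 \<le> \<kappa>" using t by (simp add: \<kappa>_def)
  have kk: "\<kappa> \<le> \<kappa>'" using le by (simp add: \<kappa>_def \<kappa>'_def)
  have C': "t1 * (1 + \<rho> + (N - \<rho>) * \<kappa>) \<le> 1"
    using C unfolding m b N_def by (simp add: algebra_simps)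
  have tk: "1 - \<kappa>\<^sup>2 \<le> t1 * (1 + N * \<kappa>)"
    using psi_ratio_square_ge[OF n0 t(1,2)] unfolding \<kappa>_def m1_def N_def by simp
  have G0: "0 \<le> 1 + \<rho> + (N - \<rho>) * \<kappa>" using r k0 unfolding N_def by simp
  have "(1 - \<kappa>\<^sup>2) * (1 + \<rho> + (N - \<rho>) * \<kappa>) \<le> (t1 * (1 + N * \<kappa>)) * (1 + \<rho> + (N - \<rho>) * \<kappa>)"
    using tk G0 by (intro mult_right_mono)
  also have "\<dots> = (1 + N * \<kappa>) * (t1 * (1 + \<rho> + (N - \<rho>) * \<kappa>))" by simp
  also have "\<dots> \<le> (1 + N * \<kappa>) * 1" using C' k0 N by (intro mult_left_mono) auto
  finally have poly: "\<rho> * (1 - \<kappa>)\<^sup>2 * (1 + \<kappa>) \<le> \<kappa>\<^sup>2 * (1 + N * \<kappa>)"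
    by (simp add: algebra_simps power2_eq_square)
  have kpos: "0 < \<kappa>"
  proof (rule ccontr)
    assume "\<not> 0 < \<kappa>"
    then have "\<kappa> = 0" using k0 by simp
    then show False using poly r by simp
  qed
  define L where "L = \<rho> + (N - \<rho>) * (\<kappa> * \<kappa>')"
  have L0: "0 \<le> L" unfolding L_def using r k0 kk unfolding N_def by simp
  have "\<rho> * (1 + N * \<kappa>) \<le> (1 + \<kappa>) * (\<rho> + (N - \<rho>) * \<kappa>\<^sup>2)\<^sup>2"
    using two_zero_peaks_polynomial_ineq[OF N r(1) _ kpos k1(1) poly] r unfolding N_def by simp
  also have "\<dots> \<le> (1 + \<kappa>) * L\<^sup>2"
  proof (intro mult_left_mono power_mono)
    have "\<kappa>\<^sup>2 \<le> \<kappa> * \<kappa>'" unfolding power2_eq_square using kk k0 by (intro mult_left_mono)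
    then show "\<rho> + (N - \<rho>) * \<kappa>\<^sup>2 \<le> L" unfolding L_def using r by (simp add: N_def mult_left_mono)
  qed (use r k0 in \<open>auto simp: N_def\<close>)
  finally have key: "\<rho> * (1 + N * \<kappa>) \<le> (1 + \<kappa>) * L\<^sup>2" .
  have "(1 + \<kappa>) * (\<rho> * (1 - \<kappa>)) = \<rho> * (1 - \<kappa>\<^sup>2)" by (simp add: algebra_simps power2_eq_square)
  also have "\<dots> \<le> \<rho> * (t1 * (1 + N * \<kappa>))" using tk r by (intro mult_left_mono) auto
  also have "\<dots> = t1 * (\<rho> * (1 + N * \<kappa>))" by simp
  also have "\<dots> \<le> t1 * ((1 + \<kappa>) * L\<^sup>2)" using key t by (intro mult_left_mono) auto
  also have "\<dots> = (1 + \<kappa>) * (t1 * L\<^sup>2)" by simp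
  finally have "\<rho> * (1 - \<kappa>) \<le> t1 * L\<^sup>2" using k0 by (simp add: mult_le_cancel_left)
  then have "t1 * (\<rho> * (1 - \<kappa>)) \<le> t1 * (t1 * L\<^sup>2)" using t by (intro mult_left_mono) auto
  then have rb: "\<rho> * b1 \<le> (t1 * L)\<^sup>2" unfolding b by (simp add: power2_eq_square mult_ac)
  have tL: "t1 * L \<le> 1"
  proof -
    have "\<kappa> * \<kappa>' \<le> \<kappa>" using k0 k1 by (simp add: mult_left_le)
    then have "(N - \<rho>) * (\<kappa> * \<kappa>') \<le> (N - \<rho>) * \<kappa>" using r unfolding N_def by (intro mult_left_mono) auto
    then have "t1 * L \<le> t1 * (1 + \<rho> + (N - \<rho>) * \<kappa>)" unfolding L_def using t by (intro mult_left_mono) auto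
    then show ?thesis using C' by simp
  qed
  have "N * (\<rho> * b1 * b2) = (\<rho> * b1) * bern n (1 - t2)" unfolding bb(2)[symmetric] by simp
  also have "\<dots> \<le> (t1 * L)\<^sup>2 * bern n (1 - t2)" using rb bern_nonneg t by (intro mult_right_mono) auto
  also have "\<dots> \<le> bern n (1 - (t1 * L) * t2)"
    using bern_scale[OF n0, of "t1 * L" t2] tL L0 t by simp
  also have "(t1 * L) * t2 = n * m1 * m2 + \<rho> * (m1 * b2 + m2 * b1) + \<rho> * b1 * b2"
    unfolding L_def m b N_def by (simp add: algebra_simps)
  finally show ?thesis unfolding N_def .
qed

text \<open>\<open>R1\<close> and \<open>R2\<close> are the excess masses of the two laws off the zero. Both ratios \<open>R1 / b1\<close> and
  \<open>R2 / b2\<close> may be lowered to their minimum \<open>\<rho>\<close>: this leaves the bound \<open>min (b1 * R2) (b2 * R1)\<close> unchanged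
  and only decreases the constant part of the atoms.\<close>

lemma two_zero_peaks_bound:
  fixes t1 t2 R1 R2 :: real
  assumes n: "n \<ge> 3" and t: "0 \<le> t1" "t1 \<le> 1" "0 \<le> t2" "t2 \<le> 1"
  defines "m1 \<equiv> psi (Suc n) t1" and "m2 \<equiv> psi (Suc n) t2"
  defines "b1 \<equiv> t1 - m1" and "b2 \<equiv> t2 - m2"
  assumes R1: "b1 \<le> R1" "R1 \<le> n * b1" "R1 + b1 + (real n + 1) * m1 \<le> 1"
    and R2: "b2 \<le> R2" "R2 \<le> n * b2" "R2 + b2 + (real n + 1) * m2 \<le> 1"
    and M1: "n * m1 * m2 + m1 * R2 + m2 * R1 + min (b1 * R2) (b2 * R1) \<le> 1"
  shows "n * min (b1 * R2) (b2 * R1) \<le> bern n (1 - (n * m1 * m2 + m1 * R2 + m2 * R1 + min (b1 * R2) (b2 * R1)))"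
proof -
  have n0: "n > 0" using n by simp
  have bb: "n * b1 = bern n (1 - t1)" "n * b2 = bern n (1 - t2)"
    unfolding b1_def b2_def m1_def m2_def psi_eq_bern[OF n0] using n0 by simp_all
  have b0: "0 \<le> b1" "0 \<le> b2"
    unfolding b1_def b2_def m1_def m2_def using psi_le_self[OF n0] t by auto
  have m0: "0 \<le> m1" "0 \<le> m2"
    unfolding m1_def m2_def using psi_nonneg t by auto
  show ?thesis
  proof (cases "b1 = 0 \<or> b2 = 0")
    case True
    then have "min (b1 * R2) (b2 * R1) = 0" using b0 R1 R2 by (auto simp: min_def mult_le_0_iff)
    then show ?thesis using M1 bern_nonneg by simp
  next
    case False
    then have bp: "0 < b1" "0 < b2" using b0 by auto
    then have tp: "0 < t1" "0 < t2" using m0 unfolding b1_def b2_def by auto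
    define \<rho> where "\<rho> = min (R1 / b1) (R2 / b2)"
    have r: "1 \<le> \<rho>" "\<rho> \<le> n" unfolding \<rho>_def using bp R1 R2 by (auto simp: min_le_iff_disj pos_divide_le_eq)
    have rb: "\<rho> * b1 \<le> R1" "\<rho> * b2 \<le> R2"
      unfolding \<rho>_def using bp by (auto simp flip: pos_le_divide_eq)
    have mn: "min (b1 * R2) (b2 * R1) = \<rho> * b1 * b2"
    proof -
      have eqs: "b1 * R2 = R2 / b2 * (b1 * b2)" "b2 * R1 = R1 / b1 * (b1 * b2)" using bp by auto
      have c: "0 \<le> b1 * b2" using bp by simp
      have "min (b1 * R2) (b2 * R1) = min (R1 / b1) (R2 / b2) * (b1 * b2)"
        unfolding eqs min_mult_distrib_right if_P[OF c] by (rule min.commute)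
      then show ?thesis unfolding \<rho>_def by simp
    qed
    have C: "(\<rho> + 1) * b1 + (real n + 1) * m1 \<le> 1" "(\<rho> + 1) * b2 + (real n + 1) * m2 \<le> 1"
      using rb R1 R2 by (auto simp: algebra_simps)
    let ?M0 = "n * m1 * m2 + \<rho> * (m1 * b2 + m2 * b1) + \<rho> * b1 * b2"
    have core: "n * (\<rho> * b1 * b2) \<le> bern n (1 - ?M0)"
    proof (cases "m1 / t1 \<le> m2 / t2")
      case True
      show ?thesis
        unfolding b1_def b2_def m1_def m2_def
        by (rule two_zero_peaks_core[OF n r tp(1) t(2) tp(2) t(4)])
          (use C True in \<open>auto simp: b1_def b2_def m1_def m2_def\<close>)
    next
      case False
      have "n * (\<rho> * b2 * b1) \<le> bern n (1 - (n * m2 * m1 + \<rho> * (m2 * b1 + m1 * b2) + \<rho> * b2 * b1))"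
        unfolding b1_def b2_def m1_def m2_def
        by (rule two_zero_peaks_core[OF n r tp(2) t(4) tp(1) t(2)])
          (use C False in \<open>auto simp: b1_def b2_def m1_def m2_def\<close>)
      then show ?thesis by (simp add: mult_ac add_ac)
    qed
    have "m1 * (\<rho> * b2) + m2 * (\<rho> * b1) \<le> m1 * R2 + m2 * R1"
      using rb m0 by (intro add_mono mult_left_mono)
    then have "?M0 \<le> n * m1 * m2 + m1 * R2 + m2 * R1 + \<rho> * b1 * b2" by (simp add: algebra_simps)
    moreover have "0 \<le> ?M0" using m0 b0 r by simp
    ultimately have "bern n (1 - ?M0) \<le> bern n (1 - (n * m1 * m2 + m1 * R2 + m2 * R1 + \<rho> * b1 * b2))"
      using M1 unfolding mn by (intro bern_antimono) auto
    then show ?thesis using core unfolding mn by linarith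
  qed
qed

section \<open>Laws in the body and their convolutions\<close>

lemma decreasing_atoms_enumeration:
  assumes "finite Q"
  obtains xs where "distinct xs" "set xs = Q" "decreasing_atoms Q p = map (pmf p) xs"
    "sorted_wrt (\<ge>) (map (pmf p) xs)"
proof -
  obtain ys where ys: "set ys = Q" "distinct ys" using finite_distinct_list[OF assms] by blast
  define zs where "zs = sort_key (pmf p) ys"
  have "sort (map (pmf p) ys) = map (pmf p) zs"
    by (rule properties_for_sort) (simp_all add: zs_def)
  moreover have "image_mset (pmf p) (mset_set Q) = mset (map (pmf p) ys)"
    using ys by (metis mset_map mset_set_set)
  ultimately have "decreasing_atoms Q p = map (pmf p) (rev zs)"
    unfolding decreasing_atoms_def by (simp only: sorted_list_of_multiset_mset rev_map)
  moreover have "sorted_wrt (\<ge>) (map (pmf p) (rev zs))"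
    using sorted_sort_key[of "pmf p" ys] unfolding zs_def rev_map[symmetric] sorted_wrt_rev by simp
  moreover have "distinct (rev zs)" "set (rev zs) = Q" using ys by (simp_all add: zs_def)
  ultimately show thesis using that by blast
qed

text \<open>A law of the body has a largest atom at some \<open>a\<close>, which need not be unique. Working with one such position
  and the second atom \<open>t\<close> replaces the sorted list of atoms.\<close>

definition peaked_at :: "nat \<Rightarrow> 'a set \<Rightarrow> 'a pmf \<Rightarrow> 'a \<Rightarrow> real \<Rightarrow> bool" where
  "peaked_at n Q p a t \<longleftrightarrow> p \<in> laws_on Q \<and> a \<in> Q \<and> t \<le> pmf p a \<and>
    (\<forall>g\<in>Q - {a}. pmf p g \<le> t) \<and> (\<exists>b\<in>Q - {a}. pmf p b = t) \<and>
    (\<forall>g\<in>Q. psi (Suc n) t \<le> pmf p g)"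

lemma body_imp_peaked_at:
  assumes fin: "finite Q" and card: "card Q = Suc n" and n: "n \<ge> 1" and p: "p \<in> body (Suc n) Q"
  obtains a t where "peaked_at n Q p a t"
proof -
  obtain xs where xs: "distinct xs" "set xs = Q" "decreasing_atoms Q p = map (pmf p) xs"
    "sorted_wrt (\<ge>) (map (pmf p) xs)" using decreasing_atoms_enumeration[OF fin] by blast
  have len: "length xs = Suc n" using xs card distinct_card by metis
  have at: "atom_at Q p (Suc i) = pmf p (xs ! i)" if "i \<le> n" for i
    unfolding atom_at_def xs(3) using that len by simp
  have mono: "pmf p (xs ! j) \<le> pmf p (xs ! i)" if "i \<le> j" "j \<le> n" for i j
    using sorted_wrt_nth_less[OF xs(4), of i j] that len by (cases "i = j") auto
  have idx: "\<exists>i\<le>n. g = xs ! i" if "g \<in> Q" for g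
    using that xs(2) len by (metis in_set_conv_nth less_Suc_eq_le)
  have in_Q: "xs ! i \<in> Q" if "i \<le> n" for i using that xs(2) len nth_mem[of i xs] by auto
  define t where "t = pmf p (xs ! 1)"
  have "psi (Suc n) t \<le> pmf p (xs ! n)"
    using p at[of n] at[of 1] n unfolding body_def t_def by (simp add: numeral_2_eq_2)
  then have low: "psi (Suc n) t \<le> pmf p g" if "g \<in> Q" for g
    using idx[OF that] mono[of _ n] by fastforce
  have "peaked_at n Q p (xs ! 0) t"
    unfolding peaked_at_def
  proof (intro conjI ballI)
    show "p \<in> laws_on Q" using p by (simp add: body_def)
    show "t \<le> pmf p (xs ! 0)" unfolding t_def using mono n by simp
    show "\<exists>b\<in>Q - {xs ! 0}. pmf p b = t"
      using in_Q[of 1] n xs(1) len nth_eq_iff_index_eq[OF xs(1), of 1 0] unfolding t_def by (intro bexI[of _ "xs ! 1"]) auto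
    show "pmf p g \<le> t" if g: "g \<in> Q - {xs ! 0}" for g
    proof -
      obtain i where i: "i \<le> n" "g = xs ! i" using idx g by blast
      then have "i \<noteq> 0" using g by (cases i) auto
      then show ?thesis unfolding t_def i(2) using mono[of 1 i] i(1) by simp
    qed
  qed (use in_Q low in auto)
  then show thesis using that by blast
qed

text \<open>If all atoms but one are at most \<open>M\<close>, then so is the second largest one, whichever point is
  exempted.\<close>

lemma body_intro:
  assumes fin: "finite Q" and card: "card Q = Suc n" and n: "n \<ge> 1" and p: "p \<in> laws_on Q"
    and upper: "\<And>g. g \<in> Q \<Longrightarrow> g \<noteq> y \<Longrightarrow> pmf p g \<le> M"
    and lower: "\<And>g. g \<in> Q \<Longrightarrow> m \<le> pmf p g"
    and psi: "\<And>s. s \<le> M \<Longrightarrow> s \<le> 1 \<Longrightarrow> psi (Suc n) s \<le> m"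
  shows "p \<in> body (Suc n) Q"
proof -
  obtain xs where xs: "distinct xs" "set xs = Q" "decreasing_atoms Q p = map (pmf p) xs"
    "sorted_wrt (\<ge>) (map (pmf p) xs)" using decreasing_atoms_enumeration[OF fin] by blast
  have len: "length xs = Suc n" using xs card distinct_card by metis
  have at: "atom_at Q p (Suc i) = pmf p (xs ! i)" if "i \<le> n" for i
    unfolding atom_at_def xs(3) using that len by simp
  have in_Q: "xs ! i \<in> Q" if "i \<le> n" for i using that xs(2) len nth_mem[of i xs] by auto
  have "pmf p (xs ! 1) \<le> M"
  proof (cases "xs ! 1 = y")
    case True
    then have "xs ! 0 \<noteq> y" using nth_eq_iff_index_eq[OF xs(1), of 1 0] n len by auto
    then have "pmf p (xs ! 0) \<le> M" using upper in_Q by simp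
    moreover have "pmf p (xs ! 1) \<le> pmf p (xs ! 0)"
      using sorted_wrt_nth_less[OF xs(4), of 0 1] n len by auto
    ultimately show ?thesis by simp
  next
    case False
    then show ?thesis using upper in_Q n by simp
  qed
  then have "psi (Suc n) (atom_at Q p 2) \<le> m"
    using psi[OF _ pmf_le_1, of p "xs ! 1"] at[of 1] n by (simp add: numeral_2_eq_2)
  also have "m \<le> atom_at Q p (Suc n)" using at[of n] lower in_Q by simp
  finally show ?thesis using p by (simp add: body_def)
qed

lemma law_sum: "finite Q \<Longrightarrow> p \<in> laws_on Q \<Longrightarrow> sum (pmf p) Q = 1"
  by (simp add: laws_on_def sum_pmf_eq_1)

lemma peaked_at_bounds:
  assumes fin: "finite Q" and card: "card Q = Suc n" and n: "n \<ge> 1" and p: "peaked_at n Q p a t"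
  shows "0 \<le> t" "t \<le> 1" "pmf p a + t + (real n - 1) * psi (Suc n) t \<le> 1"
    "0 \<le> lead n (1 - t)" "peak n \<le> 1 - t"
proof -
  obtain b where b: "b \<in> Q" "b \<noteq> a" "pmf p b = t" using p by (auto simp: peaked_at_def)
  have a: "a \<in> Q" "p \<in> laws_on Q" "t \<le> pmf p a" using p by (auto simp: peaked_at_def)
  show t: "0 \<le> t" "t \<le> 1" using b pmf_nonneg[of p b] pmf_le_1[of p b] by auto
  have "sum (pmf p) Q = pmf p a + (pmf p b + sum (pmf p) (Q - {a} - {b}))"
    using a b fin by (simp add: sum.remove)
  moreover have "real (card (Q - {a} - {b})) * psi (Suc n) t \<le> sum (pmf p) (Q - {a} - {b})"
    using p by (intro sum_bounded_below) (auto simp: peaked_at_def)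
  moreover have "real (card (Q - {a} - {b})) = real n - 1"
    using a b fin card n by (simp add: of_nat_diff)
  ultimately show s: "pmf p a + t + (real n - 1) * psi (Suc n) t \<le> 1"
    using law_sum[OF fin a(2)] b(3) by simp
  have n0: "n > 0" using n by simp
  show l: "0 \<le> lead n (1 - t)"
    using s a(3) unfolding lead_eq[OF n0] psi_eq_gap by simp
  then show "peak n \<le> 1 - t"
    using peak_le_of_lead_nonneg[OF n0, of "1 - t"] t lead_nonneg_iff[OF n0] by simp
qed

text \<open>The pairs with a given product form the graph of a permutation: left translations give a unique second
  factor, and it determines the first one since right translations are injective.\<close>

lemma quasigroup_fibre:
  assumes fin: "finite P" and q: "quasigroup_on P f" and g: "g \<in> P"
  obtains \<pi> where "bij_betw \<pi> P P" "\<forall>h\<in>P. f h (\<pi> h) = g"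
    "{(h, h') \<in> P \<times> P. f h h' = g} = (\<lambda>h. (h, \<pi> h)) ` P"
proof -
  have L: "bij_betw (f h) P P" and R: "bij_betw (\<lambda>x. f x h) P P" if "h \<in> P" for h
    using q that by (auto simp: quasigroup_on_def)
  define \<pi> where "\<pi> = (\<lambda>h. inv_into P (f h) g)"
  have \<pi>: "\<pi> h \<in> P" "f h (\<pi> h) = g" if "h \<in> P" for h
    using L[OF that] g unfolding \<pi>_def bij_betw_def by (auto intro: inv_into_into f_inv_into_f)
  have "inj_on \<pi> P"
  proof (rule inj_onI)
    fix h h' assume h: "h \<in> P" "h' \<in> P" "\<pi> h = \<pi> h'"
    then have "f h (\<pi> h) = f h' (\<pi> h)" using \<pi> by metis
    then show "h = h'" using R[OF \<pi>(1)[OF h(1)]] h unfolding bij_betw_def inj_on_def by blast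
  qed
  then have "bij_betw \<pi> P P"
    using \<pi>(1) fin by (simp add: bij_betw_def endo_inj_surj image_subsetI)
  moreover have "{(h, h') \<in> P \<times> P. f h h' = g} = (\<lambda>h. (h, \<pi> h)) ` P"
  proof -
    have "h' = \<pi> h" if "h \<in> P" "h' \<in> P" "f h h' = g" for h h'
      using L[OF that(1)] \<pi>[OF that(1)] that unfolding bij_betw_def inj_on_def by metis
    then show ?thesis using \<pi> by auto
  qed
  ultimately show thesis using that \<pi> by blast
qed

lemma pairing_sum_expand:
  fixes u v :: "'a \<Rightarrow> real" and m l :: real
  assumes "finite P" and \<pi>: "bij_betw \<pi> P P"
  shows "(\<Sum>h\<in>P. u h * v (\<pi> h)) =
    m * sum v P + l * sum u P - card P * m * l + (\<Sum>h\<in>P. (u h - m) * (v (\<pi> h) - l))"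
proof -
  have "(\<Sum>h\<in>P. v (\<pi> h)) = sum v P" using \<pi> by (rule sum.reindex_bij_betw)
  moreover have "(u h - m) * (v (\<pi> h) - l) = u h * v (\<pi> h) - m * v (\<pi> h) - l * u h + m * l" for h
    by (simp add: algebra_simps)
  ultimately show ?thesis
    by (simp add: sum.distrib sum_subtractf sum_distrib_left[symmetric])
qed

lemma pairing_sum_le_left:
  fixes e f :: "'a \<Rightarrow> real"
  assumes \<pi>: "bij_betw \<pi> P P" and e: "\<And>h. h \<in> P \<Longrightarrow> e h \<le> b" and f: "\<And>h. h \<in> P \<Longrightarrow> 0 \<le> f h"
  shows "(\<Sum>h\<in>P. e h * f (\<pi> h)) \<le> b * sum f P"
proof -
  have "(\<Sum>h\<in>P. e h * f (\<pi> h)) \<le> (\<Sum>h\<in>P. b * f (\<pi> h))"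
    using \<pi> e f bij_betwE by (intro sum_mono mult_right_mono) fast+
  also have "\<dots> = b * sum f P"
    unfolding sum_distrib_left[symmetric] using sum.reindex_bij_betw[OF \<pi>, of f] by simp
  finally show ?thesis .
qed

lemma pairing_sum_le_right:
  fixes e f :: "'a \<Rightarrow> real"
  assumes \<pi>: "bij_betw \<pi> P P" and e: "\<And>h. h \<in> P \<Longrightarrow> 0 \<le> e h" and f: "\<And>h. h \<in> P \<Longrightarrow> f h \<le> b"
  shows "(\<Sum>h\<in>P. e h * f (\<pi> h)) \<le> b * sum e P"
proof -
  have "(\<Sum>h\<in>P. e h * f (\<pi> h)) \<le> (\<Sum>h\<in>P. e h * b)"
    using \<pi> e f bij_betwE by (intro sum_mono mult_left_mono) fast+
  then show ?thesis by (simp add: sum_distrib_left mult.commute)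
qed

text \<open>Only one partner \<open>j\<close> meets the large value \<open>f a'\<close>, and \<open>e j \<le> b\<close> because \<open>j \<noteq> a\<close>. All other
  partners meet values at most \<open>c\<close>.\<close>

lemma pairing_sum_off_peak:
  fixes e f :: "'a \<Rightarrow> real"
  assumes fin: "finite P" and \<pi>: "bij_betw \<pi> P P" and a: "a' \<in> P" "\<pi> a \<noteq> a'"
    and e: "\<And>h. h \<in> P \<Longrightarrow> 0 \<le> e h" "\<And>h. h \<in> P \<Longrightarrow> h \<noteq> a \<Longrightarrow> e h \<le> b"
    and f: "\<And>h. h \<in> P \<Longrightarrow> h \<noteq> a' \<Longrightarrow> f h \<le> c" "c \<le> f a'"
  shows "(\<Sum>h\<in>P. e h * f (\<pi> h)) \<le> c * sum e P + b * (f a' - c)"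
proof -
  obtain j where j: "j \<in> P" "\<pi> j = a'" using \<pi> a(1) unfolding bij_betw_def by (metis imageE)
  have oth: "\<pi> h \<in> P" "\<pi> h \<noteq> a'" if "h \<in> P - {j}" for h
  proof -
    show "\<pi> h \<in> P" using \<pi> that bij_betwE by fast
    show "\<pi> h \<noteq> a'" using \<pi> that j inj_onD[of \<pi> P h j] by (auto simp: bij_betw_def)
  qed
  have "(\<Sum>h\<in>P - {j}. e h * f (\<pi> h)) \<le> (\<Sum>h\<in>P - {j}. e h * c)"
    using oth e f by (intro sum_mono mult_left_mono) auto
  also have "\<dots> = c * (sum e P - e j)"
  proof -
    have "(\<Sum>h\<in>P - {j}. e h * c) = c * sum e (P - {j})" by (simp add: sum_distrib_left mult.commute)
    then show ?thesis using fin j by (simp add: sum_diff1)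
  qed
  finally have "(\<Sum>h\<in>P. e h * f (\<pi> h)) \<le> c * (sum e P - e j) + e j * f a'"
    using fin j by (simp add: sum.remove[of P j])
  also have "\<dots> = c * sum e P + e j * (f a' - c)" by (simp add: algebra_simps)
  also have "\<dots> \<le> c * sum e P + b * (f a' - c)"
    using e(2)[OF j(1)] j a f(2) by (intro add_left_mono mult_right_mono) auto
  finally show ?thesis .
qed

lemma conv_closed:
  assumes "\<mu> \<in> laws_on Q" "\<nu> \<in> laws_on Q" "\<And>x y. x \<in> Q \<Longrightarrow> y \<in> Q \<Longrightarrow> f x y \<in> Q"
  shows "conv f \<mu> \<nu> \<in> laws_on Q"
  using assms by (auto simp: laws_on_def conv_def)

lemma quasigroup_on_closed: "quasigroup_on P f \<Longrightarrow> x \<in> P \<Longrightarrow> y \<in> P \<Longrightarrow> f x y \<in> P"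
  by (auto simp: quasigroup_on_def bij_betw_def)

lemma pmf_conv_fibre:
  assumes "finite Q" "\<mu> \<in> laws_on Q" "\<nu> \<in> laws_on Q"
    and "{(h, h') \<in> Q \<times> Q. f h h' = g} = (\<lambda>h. (h, \<pi> h)) ` P"
  shows "pmf (conv f \<mu> \<nu>) g = (\<Sum>h\<in>P. pmf \<mu> h * pmf \<nu> (\<pi> h))"
  unfolding pmf_conv[OF assms(1-3)] assms(4)
  by (subst sum.reindex) (auto simp: inj_on_def)

section \<open>Quasigroup operations\<close>

text \<open>Each atom of the convolution is \<open>w\<close> plus a paired sum of excesses. The latter is nonnegative, and off the
  product \<open>f a a'\<close> of the two peaks it is bounded by \<open>pairing_sum_off_peak\<close>. The resulting bounds \<open>w\<close> and \<open>M\<close>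
  correspond to the products of \<open>spread\<close> and of \<open>lead\<close>.\<close>

lemma quasigroup_conv_in_body:
  assumes fin: "finite Q" and card: "card Q = Suc n" and n: "n \<ge> 1"
    and q: "quasigroup_on Q f" and \<mu>: "peaked_at n Q \<mu> a t" and \<nu>: "peaked_at n Q \<nu> a' t'"
  shows "conv f \<mu> \<nu> \<in> body (Suc n) Q"
proof -
  define m where "m = psi (Suc n) t"
  define m' where "m' = psi (Suc n) t'"
  have n0: "n > 0" using n by simp
  note t = peaked_at_bounds[OF fin card n \<mu>] and t' = peaked_at_bounds[OF fin card n \<nu>]
  have laws: "\<mu> \<in> laws_on Q" "\<nu> \<in> laws_on Q" and a: "a \<in> Q" "a' \<in> Q"
    and up: "\<And>g. g \<in> Q \<Longrightarrow> g \<noteq> a \<Longrightarrow> pmf \<mu> g \<le> t" "\<And>g. g \<in> Q \<Longrightarrow> g \<noteq> a' \<Longrightarrow> pmf \<nu> g \<le> t'"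
    and low: "\<And>g. g \<in> Q \<Longrightarrow> m \<le> pmf \<mu> g" "\<And>g. g \<in> Q \<Longrightarrow> m' \<le> pmf \<nu> g"
    and top: "t' \<le> pmf \<nu> a'"
    using \<mu> \<nu> by (auto simp: peaked_at_def m_def m'_def)
  define k where "k = real n + 1"
  have k: "k = real (card Q)" by (simp add: k_def card)
  define w where "w = m + m' - k * m * m'"
  define M where "M = w + (t' - m') * (1 - k * m) + (t - m) * (1 - k * m' - 2 * (t' - m'))"
  have tm: "m \<le> t" using psi_le_self[OF n0 t(2)] by (simp add: m_def)
  have expand: "pmf (conv f \<mu> \<nu>) g = w + (\<Sum>h\<in>Q. (pmf \<mu> h - m) * (pmf \<nu> (\<pi> h) - m'))"
    if "bij_betw \<pi> Q Q" "{(h, h') \<in> Q \<times> Q. f h h' = g} = (\<lambda>h. (h, \<pi> h)) ` Q" for g \<pi>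
    unfolding pmf_conv_fibre[OF fin laws that(2)]
    by (subst pairing_sum_expand[OF fin that(1), of _ _ m m']) (simp add: law_sum fin laws w_def k)
  show ?thesis
  proof (rule body_intro[OF fin card n, where y = "f a a'" and M = M and m = w])
    show "conv f \<mu> \<nu> \<in> laws_on Q" by (rule conv_closed[OF laws quasigroup_on_closed[OF q]])
    show "w \<le> pmf (conv f \<mu> \<nu>) g" if g: "g \<in> Q" for g
    proof -
      obtain \<pi> where \<pi>: "bij_betw \<pi> Q Q" "{(h, h') \<in> Q \<times> Q. f h h' = g} = (\<lambda>h. (h, \<pi> h)) ` Q"
        by (rule quasigroup_fibre[OF fin q g])
      have "0 \<le> (\<Sum>h\<in>Q. (pmf \<mu> h - m) * (pmf \<nu> (\<pi> h) - m'))"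
        using low bij_betwE[OF \<pi>(1)] by (intro sum_nonneg mult_nonneg_nonneg) auto
      then show ?thesis unfolding expand[OF \<pi>] by simp
    qed
    show "pmf (conv f \<mu> \<nu>) g \<le> M" if g: "g \<in> Q" "g \<noteq> f a a'" for g
    proof -
      obtain \<pi> where \<pi>: "bij_betw \<pi> Q Q" "\<forall>h\<in>Q. f h (\<pi> h) = g"
        "{(h, h') \<in> Q \<times> Q. f h h' = g} = (\<lambda>h. (h, \<pi> h)) ` Q"
        by (rule quasigroup_fibre[OF fin q g(1)])
      have "\<pi> a \<noteq> a'" using \<pi>(2) a(1) g(2) by auto
      then have "(\<Sum>h\<in>Q. (pmf \<mu> h - m) * (pmf \<nu> (\<pi> h) - m'))
          \<le> (t' - m') * (\<Sum>h\<in>Q. pmf \<mu> h - m) + (t - m) * ((pmf \<nu> a' - m') - (t' - m'))"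
        using low up top by (intro pairing_sum_off_peak[OF fin \<pi>(1) a(2)]) auto
      also have "(\<Sum>h\<in>Q. pmf \<mu> h - m) = 1 - k * m"
        using law_sum[OF fin laws(1)] by (simp add: sum_subtractf k)
      also have "(t - m) * ((pmf \<nu> a' - m') - (t' - m')) \<le> (t - m) * (1 - k * m' - 2 * (t' - m'))"
        using t'(3) tm unfolding m'_def[symmetric] k_def by (intro mult_left_mono) (auto simp: algebra_simps)
      finally show ?thesis unfolding expand[OF \<pi>(1,3)] M_def by simp
    qed
    have E: "spread n (1 - t) = 1 - k * m" "spread n (1 - t') = 1 - k * m'"
      unfolding spread_eq[OF n0] m_def m'_def psi_eq_gap k_def by simp_all
    have D: "lead n (1 - t) = 1 - k * m - 2 * (t - m)" "lead n (1 - t') = 1 - k * m' - 2 * (t' - m')"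
      unfolding lead_eq[OF n0] psi_eq_gap[symmetric] m_def m'_def k_def by (simp_all add: algebra_simps)
    show "psi (Suc n) s \<le> w" if "s \<le> M" "s \<le> 1" for s
    proof (rule quasigroup_psi_bound[OF n0 t(5) _ t'(5) _ t(4) t'(4) _ _ that])
      show "spread n (1 - t) * spread n (1 - t') = 1 - (real n + 1) * w"
        unfolding E w_def k_def by (simp add: algebra_simps)
      show "lead n (1 - t) * lead n (1 - t') = 1 - 2 * M - (real n - 1) * w"
        unfolding D M_def w_def k_def by (simp add: algebra_simps)
    qed (use t t' in auto)
  qed
qed

section \<open>Absorbing-zero quasigroup operations\<close>

lemma absorbing_eq_zero_iff:
  assumes f: "absorbing_zero_quasigroup_on Q z f" and h: "h \<in> Q" "h' \<in> Q"
  shows "f h h' = z \<longleftrightarrow> h = z \<or> h' = z"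
proof (cases "h = z \<or> h' = z")
  case True
  then show ?thesis using f h by (auto simp: absorbing_zero_quasigroup_on_def)
next
  case False
  then have "f h h' \<in> Q - {z}"
    using f h quasigroup_on_closed[of "Q - {z}" f h h'] by (simp add: absorbing_zero_quasigroup_on_def)
  then show ?thesis using False by simp
qed

lemma absorbing_conv_zero:
  assumes fin: "finite Q" and f: "absorbing_zero_quasigroup_on Q z f"
    and laws: "\<mu> \<in> laws_on Q" "\<nu> \<in> laws_on Q"
  shows "pmf (conv f \<mu> \<nu>) z = 1 - sum (pmf \<mu>) (Q - {z}) * sum (pmf \<nu>) (Q - {z})"
proof -
  let ?P = "Q - {z}"
  have "{(h, h') \<in> Q \<times> Q. f h h' = z} = {(h, h') \<in> Q \<times> Q. h = z \<or> h' = z}"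
    using absorbing_eq_zero_iff[OF f] by auto
  then have set: "{(h, h') \<in> Q \<times> Q. f h h' = z} = Q \<times> Q - ?P \<times> ?P" by auto
  have "pmf (conv f \<mu> \<nu>) z = (\<Sum>(h, h') \<in> Q \<times> Q. pmf \<mu> h * pmf \<nu> h') - (\<Sum>(h, h') \<in> ?P \<times> ?P. pmf \<mu> h * pmf \<nu> h')"
    unfolding pmf_conv[OF fin laws] set using fin by (intro sum_diff) auto
  also have "\<dots> = sum (pmf \<mu>) Q * sum (pmf \<nu>) Q - sum (pmf \<mu>) ?P * sum (pmf \<nu>) ?P"
    by (simp add: sum.cartesian_product[symmetric] sum_product)
  finally show ?thesis using law_sum[OF fin] laws by simp
qed

lemma absorbing_conv_nonzero:
  assumes fin: "finite Q" and f: "absorbing_zero_quasigroup_on Q z f"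
    and laws: "\<mu> \<in> laws_on Q" "\<nu> \<in> laws_on Q" and g: "g \<in> Q - {z}"
  obtains \<pi> where "bij_betw \<pi> (Q - {z}) (Q - {z})" "\<forall>h\<in>Q - {z}. f h (\<pi> h) = g"
    "pmf (conv f \<mu> \<nu>) g = (\<Sum>h\<in>Q - {z}. pmf \<mu> h * pmf \<nu> (\<pi> h))"
proof -
  let ?P = "Q - {z}"
  have q: "quasigroup_on ?P f" and finP: "finite ?P"
    using f fin by (auto simp: absorbing_zero_quasigroup_on_def)
  obtain \<pi> where \<pi>: "bij_betw \<pi> ?P ?P" "\<forall>h\<in>?P. f h (\<pi> h) = g"
    "{(h, h') \<in> ?P \<times> ?P. f h h' = g} = (\<lambda>h. (h, \<pi> h)) ` ?P"
    by (rule quasigroup_fibre[OF finP q g])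
  have "{(h, h') \<in> Q \<times> Q. f h h' = g} = {(h, h') \<in> ?P \<times> ?P. f h h' = g}"
    using absorbing_eq_zero_iff[OF f] g by auto
  then have "pmf (conv f \<mu> \<nu>) g = (\<Sum>h\<in>?P. pmf \<mu> h * pmf \<nu> (\<pi> h))"
    unfolding \<pi>(3) by (rule pmf_conv_fibre[OF fin laws])
  then show thesis by (rule that[OF \<pi>(1,2)])
qed

text \<open>Off the zero this is the constant part of the expansion of the paired sum. At the zero the atom is
  \<open>1 - S * T = pmf \<mu> z * T + pmf \<nu> z\<close>, which is larger term by term.\<close>

lemma absorbing_conv_ge:
  fixes m l :: real
  assumes fin: "finite Q" and card: "card Q = Suc n" and f: "absorbing_zero_quasigroup_on Q z f"
    and laws: "\<mu> \<in> laws_on Q" "\<nu> \<in> laws_on Q"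
    and m: "0 \<le> m" "\<And>g. g \<in> Q \<Longrightarrow> m \<le> pmf \<mu> g" and l: "0 \<le> l" "\<And>g. g \<in> Q \<Longrightarrow> l \<le> pmf \<nu> g"
    and g: "g \<in> Q"
  defines "S \<equiv> sum (pmf \<mu>) (Q - {z})" and "T \<equiv> sum (pmf \<nu>) (Q - {z})"
  shows "m * T + l * (S - n * m) \<le> pmf (conv f \<mu> \<nu>) g"
proof -
  let ?P = "Q - {z}"
  have z: "z \<in> Q" using f by (simp add: absorbing_zero_quasigroup_on_def)
  have cP: "card ?P = n" using z card fin by simp
  have ST: "S = 1 - pmf \<mu> z" "T = 1 - pmf \<nu> z"
    using law_sum[OF fin laws(1)] law_sum[OF fin laws(2)] z fin
    unfolding S_def T_def by (simp_all add: sum_diff1)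
  show ?thesis
  proof (cases "g = z")
    case True
    have nm: "n * m \<le> S" unfolding S_def using sum_bounded_below[of ?P m "pmf \<mu>"] m cP by simp
    have "m * T + l * (S - n * m) \<le> pmf \<mu> z * T + pmf \<nu> z * 1"
    proof (intro add_mono mult_mono)
      show "S - n * m \<le> 1" using m(1) pmf_nonneg[of \<mu> z] unfolding ST by (smt (verit) mult_nonneg_nonneg of_nat_0_le_iff)
    qed (use m l z nm ST pmf_le_1[of \<nu> z] in auto)
    also have "\<dots> = 1 - S * T" unfolding ST by (simp add: algebra_simps)
    finally show ?thesis
      using absorbing_conv_zero[OF fin f laws] True unfolding S_def T_def by simp
  next
    case False
    then have gP: "g \<in> ?P" using g by simp
    obtain \<pi> where \<pi>: "bij_betw \<pi> ?P ?P" "pmf (conv f \<mu> \<nu>) g = (\<Sum>h\<in>?P. pmf \<mu> h * pmf \<nu> (\<pi> h))"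
      by (rule absorbing_conv_nonzero[OF fin f laws gP])
    have "0 \<le> (\<Sum>h\<in>?P. (pmf \<mu> h - m) * (pmf \<nu> (\<pi> h) - l))"
      using m l bij_betwE[OF \<pi>(1)] by (intro sum_nonneg mult_nonneg_nonneg) auto
    then show ?thesis
      unfolding \<pi>(2) using pairing_sum_expand[OF _ \<pi>(1), of "pmf \<mu>" "pmf \<nu>" m l] fin cP
      unfolding S_def T_def by (simp add: algebra_simps)
  qed
qed

lemma absorbing_conv_le_on_nonzero:
  fixes m l :: real
  assumes fin: "finite Q" and card: "card Q = Suc n" and f: "absorbing_zero_quasigroup_on Q z f"
    and laws: "\<mu> \<in> laws_on Q" "\<nu> \<in> laws_on Q"
    and m: "\<And>g. g \<in> Q \<Longrightarrow> m \<le> pmf \<mu> g" and l: "\<And>g. g \<in> Q \<Longrightarrow> l \<le> pmf \<nu> g"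
    and g: "g \<in> Q - {z}"
  defines "S \<equiv> sum (pmf \<mu>) (Q - {z})" and "T \<equiv> sum (pmf \<nu>) (Q - {z})"
  shows "(\<And>h. h \<in> Q - {z} \<Longrightarrow> pmf \<mu> h \<le> t) \<Longrightarrow>
      pmf (conv f \<mu> \<nu>) g \<le> m * T + l * (S - n * m) + (t - m) * (T - n * l)" (is "PROP ?L \<Longrightarrow> _")
    and "(\<And>h. h \<in> Q - {z} \<Longrightarrow> pmf \<nu> h \<le> t') \<Longrightarrow>
      pmf (conv f \<mu> \<nu>) g \<le> m * T + l * (S - n * m) + (t' - l) * (S - n * m)" (is "PROP ?R \<Longrightarrow> _")
proof -
  let ?P = "Q - {z}"
  have z: "z \<in> Q" using f by (simp add: absorbing_zero_quasigroup_on_def)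
  have cP: "card ?P = n" using z card fin by simp
  obtain \<pi> where \<pi>: "bij_betw \<pi> ?P ?P" "pmf (conv f \<mu> \<nu>) g = (\<Sum>h\<in>?P. pmf \<mu> h * pmf \<nu> (\<pi> h))"
    by (rule absorbing_conv_nonzero[OF fin f laws g])
  have eq: "pmf (conv f \<mu> \<nu>) g = m * T + l * (S - n * m) + (\<Sum>h\<in>?P. (pmf \<mu> h - m) * (pmf \<nu> (\<pi> h) - l))"
    unfolding \<pi>(2) S_def T_def using pairing_sum_expand[OF _ \<pi>(1), of "pmf \<mu>" "pmf \<nu>" m l] fin cP
    by (simp add: algebra_simps)
  have sums: "(\<Sum>h\<in>?P. pmf \<mu> h - m) = S - n * m" "(\<Sum>h\<in>?P. pmf \<nu> h - l) = T - n * l"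
    unfolding S_def T_def by (simp_all only: sum_subtractf sum_constant cP)
  show "pmf (conv f \<mu> \<nu>) g \<le> m * T + l * (S - n * m) + (t - m) * (T - n * l)" if "PROP ?L"
    unfolding eq using pairing_sum_le_left[OF \<pi>(1), of "\<lambda>h. pmf \<mu> h - m" "t - m" "\<lambda>h. pmf \<nu> h - l"]
      that l sums by simp
  show "pmf (conv f \<mu> \<nu>) g \<le> m * T + l * (S - n * m) + (t' - l) * (S - n * m)" if "PROP ?R"
    unfolding eq using pairing_sum_le_right[OF \<pi>(1), of "\<lambda>h. pmf \<mu> h - m" "\<lambda>h. pmf \<nu> h - l" "t' - l"]
      that m sums by simp
qed

lemma peaked_at_nonzero:
  assumes fin: "finite Q" and card: "card Q = Suc n" and n: "n \<ge> 1" and p: "peaked_at n Q p a t"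
    and z: "z \<in> Q"
  defines "S \<equiv> sum (pmf p) (Q - {z})" and "m \<equiv> psi (Suc n) t"
  shows "S = 1 - pmf p z" "n * m \<le> S" "n * m \<le> 1 - t" "0 \<le> m" "a \<noteq> z \<Longrightarrow> 1 - t \<le> S"
    "a = z \<Longrightarrow> t - m \<le> S - n * m" "a = z \<Longrightarrow> S - n * m \<le> n * (t - m)"
    "a = z \<Longrightarrow> (S - n * m) + (t - m) + (real n + 1) * m \<le> 1"
proof -
  let ?P = "Q - {z}"
  note b = peaked_at_bounds[OF fin card n p]
  have p': "p \<in> laws_on Q" "a \<in> Q" "t \<le> pmf p a" "\<And>g. g \<in> Q \<Longrightarrow> m \<le> pmf p g"
    "\<And>g. g \<in> Q \<Longrightarrow> g \<noteq> a \<Longrightarrow> pmf p g \<le> t"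
    using p by (auto simp: peaked_at_def m_def)
  have cP: "card ?P = n" using z card fin by simp
  show S: "S = 1 - pmf p z"
    using law_sum[OF fin p'(1)] z fin unfolding S_def by (simp add: sum_diff1)
  show m0: "0 \<le> m" unfolding m_def using psi_nonneg b by simp
  show "n * m \<le> S" unfolding S_def using sum_bounded_below[of ?P m "pmf p"] p' cP by simp
  have "m \<le> pmf p a" using p' by simp
  then show "n * m \<le> 1 - t" using b(3) unfolding m_def[symmetric] by (simp add: algebra_simps)
  show "1 - t \<le> S" if "a \<noteq> z" using p'(5)[OF z] that S by simp
  assume az: "a = z"
  obtain c where c: "c \<in> ?P" "pmf p c = t" using p az by (auto simp: peaked_at_def)
  have "pmf p c - m \<le> (\<Sum>h\<in>?P. pmf p h - m)"
    using c fin p' by (intro member_le_sum) auto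
  moreover have "(\<Sum>h\<in>?P. pmf p h - m) = S - n * m"
    unfolding S_def by (simp only: sum_subtractf sum_constant cP)
  moreover have "(\<Sum>h\<in>?P. pmf p h - m) \<le> (\<Sum>h\<in>?P. t - m)"
    using p' az by (intro sum_mono) auto
  ultimately show "t - m \<le> S - n * m" "S - n * m \<le> n * (t - m)"
    using c by (simp_all only: sum_constant cP)
  show "(S - n * m) + (t - m) + (real n + 1) * m \<le> 1"
    using S p'(3) az by (simp add: algebra_simps)
qed

text \<open>By monotonicity \<open>S\<close> and \<open>T\<close> may be replaced by \<open>s\<close> and \<open>r\<close>. With excess masses
  \<open>s - n * m \<le> s ^ Suc n\<close> and \<open>r - n * l \<le> r ^ Suc n\<close>, the product of the excess masses is at most
  \<open>(s * r) ^ Suc n\<close>, and the rest of \<open>s * r\<close> is spread evenly. So the class of laws with second atom at the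
  zero is stable, with equality in the extremal case.\<close>

lemma absorbing_floor:
  fixes S T s r m l :: real
  assumes n: "n \<ge> 1" and s: "s \<le> S" "n * m \<le> s" "gap n s \<le> n * m" "0 \<le> m"
    and r: "r \<le> T" "n * l \<le> r" "gap n r \<le> n * l" "0 \<le> l"
  shows "gap n (s * r) / n \<le> m * T + l * (S - n * m)"
proof -
  have "(s - n * m) * (r - n * l) \<le> s ^ Suc n * r ^ Suc n"
    using s r unfolding gap_def by (intro mult_mono) auto
  then have "gap n (s * r) \<le> n * (m * r + l * (s - n * m))"
    unfolding gap_def power_mult_distrib by (simp add: algebra_simps)
  also have "\<dots> \<le> n * (m * T + l * (S - n * m))"
    using s r by (intro mult_left_mono add_mono) auto
  finally show ?thesis using n by (simp add: pos_divide_le_eq mult.commute)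
qed

lemma absorbing_closed:
  "absorbing_zero_quasigroup_on Q z f \<Longrightarrow> x \<in> Q \<Longrightarrow> y \<in> Q \<Longrightarrow> f x y \<in> Q"
  by (cases "x = z \<or> y = z") (auto simp: absorbing_zero_quasigroup_on_def dest: quasigroup_on_closed)

text \<open>The smallest atom is at least \<open>gap n (s * r) / n\<close> for every \<open>s\<close> between \<open>x = 1 - t\<close> and \<open>S\<close> and every \<open>r\<close> between
  \<open>y = 1 - t'\<close> and \<open>T\<close>. If \<open>x * y\<close> is at least \<open>peak n\<close>, take \<open>s * r = x * y\<close>, since \<open>1 - x * y\<close> bounds all atoms
  off the product of the peaks. If \<open>peak n\<close> lies between \<open>x * y\<close> and \<open>S * T\<close>, take \<open>s * r = peak n\<close>; then the
  smallest atom is at least the maximum of \<open>psi\<close>. If \<open>S * T\<close> is below \<open>peak n\<close>, the zero carries more than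
  \<open>1 - peak n\<close>, the remaining atoms share the mass \<open>S * T\<close>, and \<open>conjugate_gap\<close> applies.\<close>

lemma absorbing_conv_in_body_no_zero_peak:
  assumes fin: "finite Q" and card: "card Q = Suc n" and n: "n \<ge> 1"
    and f: "absorbing_zero_quasigroup_on Q z f"
    and \<mu>: "peaked_at n Q \<mu> a t" "a \<noteq> z" and \<nu>: "peaked_at n Q \<nu> a' t'" "a' \<noteq> z"
  shows "conv f \<mu> \<nu> \<in> body (Suc n) Q"
proof -
  let ?P = "Q - {z}"
  define m where "m = psi (Suc n) t"
  define l where "l = psi (Suc n) t'"
  define S where "S = sum (pmf \<mu>) ?P"
  define T where "T = sum (pmf \<nu>) ?P"
  have n0: "n > 0" using n by simp
  have z: "z \<in> Q" using f by (simp add: absorbing_zero_quasigroup_on_def)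
  have laws: "\<mu> \<in> laws_on Q" "\<nu> \<in> laws_on Q" and a: "a \<in> Q" "a' \<in> Q"
    and up: "\<And>g. g \<in> Q \<Longrightarrow> g \<noteq> a \<Longrightarrow> pmf \<mu> g \<le> t" "\<And>g. g \<in> Q \<Longrightarrow> g \<noteq> a' \<Longrightarrow> pmf \<nu> g \<le> t'"
    and low: "\<And>g. g \<in> Q \<Longrightarrow> m \<le> pmf \<mu> g" "\<And>g. g \<in> Q \<Longrightarrow> l \<le> pmf \<nu> g"
    and top: "t' \<le> pmf \<nu> a'"
    using \<mu> \<nu> by (auto simp: peaked_at_def m_def l_def)
  note t = peaked_at_bounds[OF fin card n \<mu>(1), folded m_def]
    and t' = peaked_at_bounds[OF fin card n \<nu>(1), folded l_def]
  note P = peaked_at_nonzero[OF fin card n \<mu>(1) z, folded m_def S_def]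
    and P' = peaked_at_nonzero[OF fin card n \<nu>(1) z, folded l_def T_def]
  define x where "x = 1 - t"
  define y where "y = 1 - t'"
  define w where "w = m * T + l * (S - n * m)"
  have xS: "x \<le> S" "S \<le> 1" and yT: "y \<le> T" "T \<le> 1"
    using P(1,5) P'(1,5) \<mu> \<nu> by (auto simp: x_def y_def)
  have pk: "0 < peak n" "peak n \<le> x" "peak n \<le> y"
    using peak_pos[OF n0] t t' by (auto simp: x_def y_def)
  have ge: "w \<le> pmf (conv f \<mu> \<nu>) g" if "g \<in> Q" for g
    unfolding w_def S_def T_def using absorbing_conv_ge[OF fin card f laws P(4) low(1) P'(4) low(2) that] .
  have zero: "pmf (conv f \<mu> \<nu>) z = 1 - S * T"
    using absorbing_conv_zero[OF fin f laws] unfolding S_def T_def .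
  have closed: "conv f \<mu> \<nu> \<in> laws_on Q" by (rule conv_closed[OF laws absorbing_closed[OF f]])
  have nm: "n * m = gap n x" "n * l = gap n y"
    unfolding m_def l_def x_def y_def psi_eq_gap using n0 by simp_all
  have floor: "gap n (s * r) / n \<le> w" if "x \<le> s" "s \<le> S" "y \<le> r" "r \<le> T" for s r
    unfolding w_def
  proof (rule absorbing_floor[OF n that(2) _ _ P(4) that(4) _ _ P'(4)])
    show "n * m \<le> s" "n * l \<le> r" using P(3) P'(3) that by (auto simp: x_def y_def)
    show "gap n s \<le> n * m" "gap n r \<le> n * l"
      unfolding nm using gap_antimono[OF n0] pk that by auto
  qed
  consider "peak n \<le> x * y" | "x * y < peak n" "peak n \<le> S * T" | "S * T < peak n" by linarith
  then show ?thesis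
  proof cases
    case 1
    show ?thesis
    proof (rule body_intro[OF fin card n closed, where y = "f a a'" and M = "1 - x * y", OF _ ge])
      \<comment> \<open>the zero receives at most \<open>1 - x * y\<close> because neither law puts more than its second atom there\<close>
      have "x * y \<le> S * T" using xS yT pk by (intro mult_mono) auto
      then have *: "pmf (conv f \<mu> \<nu>) z \<le> 1 - x * y" using zero by simp
      show "pmf (conv f \<mu> \<nu>) g \<le> 1 - x * y" if g: "g \<in> Q" "g \<noteq> f a a'" for g
      proof (cases "g = z")
        case False
        then have gP: "g \<in> ?P" using g by simp
        obtain \<pi> where \<pi>: "bij_betw \<pi> ?P ?P" "\<forall>h\<in>?P. f h (\<pi> h) = g"
          "pmf (conv f \<mu> \<nu>) g = (\<Sum>h\<in>?P. pmf \<mu> h * pmf \<nu> (\<pi> h))"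
          by (rule absorbing_conv_nonzero[OF fin f laws gP])
        have "\<pi> a \<noteq> a'" using \<pi>(2) a \<mu>(2) g(2) by auto
        then have "pmf (conv f \<mu> \<nu>) g \<le> t' * S + t * (pmf \<nu> a' - t')"
          unfolding \<pi>(3) S_def using fin a \<nu>(2) up top by (intro pairing_sum_off_peak[OF _ \<pi>(1)]) auto
        also have "\<dots> \<le> t' * 1 + t * (1 - t')"
        proof (intro add_mono mult_left_mono)
          show "pmf \<nu> a' - t' \<le> 1 - t'" by (simp add: pmf_le_1)
        qed (use xS t t' in auto)
        also have "\<dots> = 1 - x * y" by (simp add: x_def y_def algebra_simps)
        finally show ?thesis .
      qed (use * in simp)
      show "psi (Suc n) s \<le> w" if "s \<le> 1 - x * y" "s \<le> 1" for s
        using psi_le_of_le[OF n0 that(1) _ _ that(2)] 1 floor[of x y] xS yT by (simp add: psi_eq_gap)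
    qed
  next
    case 2
    have "\<exists>s r. x \<le> s \<and> s \<le> S \<and> y \<le> r \<and> r \<le> T \<and> s * r = peak n"
    proof (cases "peak n \<le> x * T")
      case True
      have xp: "0 < x" using pk by linarith
      have "y \<le> peak n / x" "peak n / x \<le> T"
        using True 2 xp by (simp_all add: pos_le_divide_eq pos_divide_le_eq mult.commute)
      then show ?thesis using xS xp by (intro exI[of _ x] exI[of _ "peak n / x"]) simp
    next
      case False
      have Tp: "0 < T" using pk yT by linarith
      have "x \<le> peak n / T" "peak n / T \<le> S"
        using False 2 Tp by (simp_all add: pos_le_divide_eq pos_divide_le_eq)
      then show ?thesis using yT Tp by (intro exI[of _ "peak n / T"] exI[of _ T]) simp
    qed
    then obtain s r where sr: "x \<le> s" "s \<le> S" "y \<le> r" "r \<le> T" "s * r = peak n" by blast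
    have top: "gap n (peak n) / n \<le> w" using floor[OF sr(1-4)] unfolding sr(5) .
    show ?thesis
    proof (rule body_intro[OF fin card n closed, where y = z and M = 1, OF _ ge])
      show "psi (Suc n) s \<le> w" if "s \<le> 1" for s by (rule psi_le_of_peak[OF n0 top that])
    qed (simp add: pmf_le_1)
  next
    case 3
    define X where "X = S * T"
    define u where "u = gap n X / n"
    have X: "0 \<le> X" "X \<le> peak n" unfolding X_def using 3 xS yT pk by auto
    have uw: "u \<le> w" unfolding u_def X_def using floor[of S T] xS yT by simp
    define M where "M = X - (real n - 1) * u"
    have Y: "peak n \<le> 1 - M" "gap n (1 - M) \<le> gap n X"
      using conjugate_gap[OF n0 X] unfolding M_def u_def by (simp_all add: algebra_simps)
    show ?thesis
    proof (rule body_intro[OF fin card n closed, where y = z and M = M and m = u])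
      show "u \<le> pmf (conv f \<mu> \<nu>) g" if "g \<in> Q" for g using ge[OF that] uw by simp
      show "pmf (conv f \<mu> \<nu>) g \<le> M" if g: "g \<in> Q" "g \<noteq> z" for g
      proof -
        let ?c = "pmf (conv f \<mu> \<nu>)"
        have "sum ?c Q = ?c z + (?c g + sum ?c (Q - {z} - {g}))"
          using z g fin by (simp add: sum.remove)
        moreover have "real (card (Q - {z} - {g})) * u \<le> sum ?c (Q - {z} - {g})"
          using ge uw by (intro sum_bounded_below) (auto intro: order_trans)
        moreover have "real (card (Q - {z} - {g})) = real n - 1"
          using z g fin card n by (simp add: of_nat_diff)
        ultimately show ?thesis using law_sum[OF fin closed] zero unfolding M_def X_def by simp
      qed
      show "psi (Suc n) s \<le> u" if "s \<le> M" "s \<le> 1" for s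
        using psi_le_of_le[OF n0 that(1) _ _ that(2)] Y unfolding u_def
        by (simp add: psi_eq_gap divide_right_mono)
    qed
  qed
qed

text \<open>The condition \<open>psi (Suc n) (w + e) \<le> w\<close> of \<open>body_intro\<close>, restated as a bound on the admissible excess \<open>e\<close>.\<close>

lemma body_intro_off_zero:
  fixes w e :: real
  assumes fin: "finite Q" and card: "card Q = Suc n" and n: "n \<ge> 1" and laws: "c \<in> laws_on Q"
    and low: "\<And>g. g \<in> Q \<Longrightarrow> w \<le> pmf c g" and up: "\<And>g. g \<in> Q \<Longrightarrow> g \<noteq> z \<Longrightarrow> pmf c g \<le> w + e"
    and e: "n * e \<le> bern n (1 - (w + e))" and pk: "w + e \<le> 1 - peak n"
  shows "c \<in> body (Suc n) Q"
proof (rule body_intro[OF fin card n laws up low])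
  have n0: "n > 0" using n by simp
  show "psi (Suc n) s \<le> w" if "s \<le> w + e" "s \<le> 1" for s
  proof (rule psi_le_of_le[OF n0 that(1) pk _ that(2)])
    have "e \<le> bern n (1 - (w + e)) / n" using e n0 by (simp add: pos_le_divide_eq mult.commute)
    then show "psi (Suc n) (w + e) \<le> w" unfolding psi_eq_bern[OF n0] by simp
  qed
qed

text \<open>Off the zero the excess of \<open>\<mu>\<close> is at most \<open>b\<close> at each point, so a paired sum is at most \<open>b * R\<close>. Since \<open>\<nu>\<close>
  has its peak elsewhere, its mass at the zero is at most \<open>t'\<close>, and monotonicity of \<open>psi\<close> yields \<open>R \<le> T ^ Suc n\<close>.\<close>

lemma absorbing_conv_in_body_one_zero_peak:
  assumes fin: "finite Q" and card: "card Q = Suc n" and n3: "n \<ge> 3"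
    and f: "absorbing_zero_quasigroup_on Q z f"
    and \<mu>: "peaked_at n Q \<mu> z t" and \<nu>: "peaked_at n Q \<nu> a' t'" "a' \<noteq> z"
  shows "conv f \<mu> \<nu> \<in> body (Suc n) Q"
proof -
  let ?P = "Q - {z}"
  define m where "m = psi (Suc n) t"
  define l where "l = psi (Suc n) t'"
  define S where "S = sum (pmf \<mu>) ?P"
  define T where "T = sum (pmf \<nu>) ?P"
  have n: "n \<ge> 1" and n0: "n > 0" using n3 by simp_all
  have z: "z \<in> Q" using f by (simp add: absorbing_zero_quasigroup_on_def)
  have laws: "\<mu> \<in> laws_on Q" "\<nu> \<in> laws_on Q"
    and up: "\<And>g. g \<in> Q - {z} \<Longrightarrow> pmf \<mu> g \<le> t"
    and low: "\<And>g. g \<in> Q \<Longrightarrow> m \<le> pmf \<mu> g" "\<And>g. g \<in> Q \<Longrightarrow> l \<le> pmf \<nu> g"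
    using \<mu> \<nu> by (auto simp: peaked_at_def m_def l_def)
  note t = peaked_at_bounds[OF fin card n \<mu>(1), folded m_def]
    and t' = peaked_at_bounds[OF fin card n \<nu>(1), folded l_def]
  note P = peaked_at_nonzero[OF fin card n \<mu>(1) z, folded m_def S_def]
    and P' = peaked_at_nonzero[OF fin card n \<nu>(1) z, folded l_def T_def]
  define w where "w = m * T + l * (S - n * m)"
  define b where "b = t - m"
  define R where "R = T - n * l"
  have b0: "0 \<le> b" using psi_le_self[OF n0 t(2)] by (simp add: b_def m_def)
  have bb: "bern n (1 - t) / n = b" "gap n (1 - t) / n = m"
    unfolding b_def m_def psi_eq_gap using psi_eq_bern[OF n0, of t] unfolding psi_eq_gap by simp_all
  have T: "0 \<le> T" "T \<le> 1" "1 - t' \<le> T" using P' \<nu>(2) pmf_nonneg[of \<nu> z] t' by auto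
  have R: "0 \<le> R" "R \<le> T ^ Suc n"
  proof -
    show "0 \<le> R" using P'(2) by (simp add: R_def)
    have "gap n T \<le> gap n (1 - t')" using gap_antimono[OF n0 t'(5) T(3)] .
    also have "\<dots> = n * l" unfolding l_def psi_eq_gap using n0 by simp
    finally show "R \<le> T ^ Suc n" unfolding R_def gap_def by simp
  qed
  have D: "real n \<le> (real n + 1) * (1 - t) + (real n - 1) * (1 - t) ^ Suc n"
    using t(4) lead_nonneg_iff[OF n0] by simp
  have one: "n * (b * R) \<le> bern n (1 - (m * T + l * b + b * R))"
    using one_zero_peak_bound[OF n3 _ _ D T(1,2) P'(4) R(1) R_def R(2)] t unfolding bb by simp
  have wM: "m * T + l * b \<le> w"
    unfolding w_def b_def using P(6) P'(4) by (simp add: mult_left_mono)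
  have wt: "w + b * R \<le> t"
  proof -
    have "w + b * R \<le> m * T + l * (n * b) + b * R"
      unfolding w_def b_def using P(7) P'(4) by (simp add: mult_left_mono)
    also have "\<dots> = t * T" unfolding R_def b_def by (simp add: algebra_simps)
    also have "\<dots> \<le> t" using T t by (simp add: mult_left_le)
    finally show ?thesis .
  qed
  have "0 \<le> 1 - (w + b * R)" using wt t by simp
  moreover have "0 \<le> m * T + l * b + b * R" using P(4) P'(4) T b0 R by simp
  ultimately have "bern n (1 - (m * T + l * b + b * R)) \<le> bern n (1 - (w + b * R))"
    using wM by (intro bern_antimono) auto
  then have e: "n * (b * R) \<le> bern n (1 - (w + b * R))" using one by linarith
  show ?thesis
  proof (rule body_intro_off_zero[OF fin card n _ _ _ e])
    show "conv f \<mu> \<nu> \<in> laws_on Q" by (rule conv_closed[OF laws absorbing_closed[OF f]])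
    show "w \<le> pmf (conv f \<mu> \<nu>) g" if "g \<in> Q" for g
      unfolding w_def S_def T_def using absorbing_conv_ge[OF fin card f laws P(4) low(1) P'(4) low(2) that] .
    show "pmf (conv f \<mu> \<nu>) g \<le> w + b * R" if "g \<in> Q" "g \<noteq> z" for g
      using absorbing_conv_le_on_nonzero(1)[OF fin card f laws low, of g t] that up
      unfolding w_def b_def R_def S_def T_def by simp
    show "w + b * R \<le> 1 - peak n" using wt t(5) by simp
  qed
qed

text \<open>Each excess is now bounded pointwise off the zero, so a paired sum has two upper bounds; both are needed.\<close>

lemma absorbing_conv_in_body_two_zero_peaks:
  assumes fin: "finite Q" and card: "card Q = Suc n" and n3: "n \<ge> 3"
    and f: "absorbing_zero_quasigroup_on Q z f"
    and \<mu>: "peaked_at n Q \<mu> z t" and \<nu>: "peaked_at n Q \<nu> z t'"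
  shows "conv f \<mu> \<nu> \<in> body (Suc n) Q"
proof -
  let ?P = "Q - {z}"
  define m where "m = psi (Suc n) t"
  define l where "l = psi (Suc n) t'"
  define S where "S = sum (pmf \<mu>) ?P"
  define T where "T = sum (pmf \<nu>) ?P"
  have n: "n \<ge> 1" and n0: "n > 0" using n3 by simp_all
  have z: "z \<in> Q" using f by (simp add: absorbing_zero_quasigroup_on_def)
  have laws: "\<mu> \<in> laws_on Q" "\<nu> \<in> laws_on Q"
    and up: "\<And>g. g \<in> Q - {z} \<Longrightarrow> pmf \<mu> g \<le> t" "\<And>g. g \<in> Q - {z} \<Longrightarrow> pmf \<nu> g \<le> t'"
    and low: "\<And>g. g \<in> Q \<Longrightarrow> m \<le> pmf \<mu> g" "\<And>g. g \<in> Q \<Longrightarrow> l \<le> pmf \<nu> g"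
    using \<mu> \<nu> by (auto simp: peaked_at_def m_def l_def)
  note t = peaked_at_bounds[OF fin card n \<mu>, folded m_def]
    and t' = peaked_at_bounds[OF fin card n \<nu>, folded l_def]
  note P = peaked_at_nonzero[OF fin card n \<mu> z, folded m_def S_def]
    and P' = peaked_at_nonzero[OF fin card n \<nu> z, folded l_def T_def]
  define w where "w = m * T + l * (S - n * m)"
  define e where "e = min ((t - m) * (T - n * l)) ((t' - l) * (S - n * m))"
  have b0: "0 \<le> t - m" using psi_le_self[OF n0 t(2)] by (simp add: m_def)
  have T: "0 \<le> T" "T \<le> 1" using P'(1) pmf_nonneg[of \<nu> z] pmf_le_1[of \<nu> z] by auto
  have w: "w = n * m * l + m * (T - n * l) + l * (S - n * m)"
    unfolding w_def by (simp add: algebra_simps)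
  have wt: "w + e \<le> t"
  proof -
    have "w + e \<le> m * T + l * (n * (t - m)) + (t - m) * (T - n * l)"
      unfolding w_def e_def using P(4,7) P'(4) by (intro add_mono mult_left_mono) auto
    also have "\<dots> = t * T" by (simp add: algebra_simps)
    also have "\<dots> \<le> t" using T t by (simp add: mult_left_le)
    finally show ?thesis .
  qed
  have e: "n * e \<le> bern n (1 - (w + e))"
    using two_zero_peaks_bound[OF n3 t(1,2) t'(1,2), folded m_def l_def, of "S - n * m" "T - n * l"]
      P(6-8) P'(6-8) wt t(2) unfolding w e_def by simp
  show ?thesis
  proof (rule body_intro_off_zero[OF fin card n _ _ _ e])
    show "conv f \<mu> \<nu> \<in> laws_on Q" by (rule conv_closed[OF laws absorbing_closed[OF f]])
    show "w \<le> pmf (conv f \<mu> \<nu>) g" if "g \<in> Q" for g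
      unfolding w_def S_def T_def using absorbing_conv_ge[OF fin card f laws P(4) low(1) P'(4) low(2) that] .
    show "pmf (conv f \<mu> \<nu>) g \<le> w + e" if "g \<in> Q" "g \<noteq> z" for g
      using absorbing_conv_le_on_nonzero(1)[OF fin card f laws low, of g t]
        absorbing_conv_le_on_nonzero(2)[OF fin card f laws low, of g t'] that up
      unfolding w_def e_def S_def T_def by simp
    show "w + e \<le> 1 - peak n" using wt t(5) by simp
  qed
qed

lemma conv_swap: "conv (\<lambda>x y. f y x) \<nu> \<mu> = conv f \<mu> \<nu>"
proof -
  have "conv f \<mu> \<nu> = map_pmf (\<lambda>(x, y). f x y) (map_pmf (\<lambda>(x, y). (y, x)) (pair_pmf \<nu> \<mu>))"
    unfolding conv_def by (subst pair_commute_pmf) simp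
  then show ?thesis unfolding conv_def by (simp add: pmf.map_comp o_def split_def)
qed

lemma absorbing_swap:
  "absorbing_zero_quasigroup_on Q z f \<Longrightarrow> absorbing_zero_quasigroup_on Q z (\<lambda>x y. f y x)"
  by (auto simp: absorbing_zero_quasigroup_on_def quasigroup_on_def)

lemma absorbing_conv_in_body:
  assumes fin: "finite Q" and card: "card Q = Suc n" and n3: "n \<ge> 3"
    and f: "absorbing_zero_quasigroup_on Q z f"
    and \<mu>: "peaked_at n Q \<mu> a t" and \<nu>: "peaked_at n Q \<nu> a' t'"
  shows "conv f \<mu> \<nu> \<in> body (Suc n) Q"
proof (cases "a = z"; cases "a' = z")
  assume "a = z" "a' = z"
  then show ?thesis using absorbing_conv_in_body_two_zero_peaks[OF fin card n3 f] \<mu> \<nu> by simp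
next
  assume "a = z" "a' \<noteq> z"
  then show ?thesis using absorbing_conv_in_body_one_zero_peak[OF fin card n3 f] \<mu> \<nu> by simp
next
  assume "a \<noteq> z" "a' = z"
  then have "conv (\<lambda>x y. f y x) \<nu> \<mu> \<in> body (Suc n) Q"
    using absorbing_conv_in_body_one_zero_peak[OF fin card n3 absorbing_swap[OF f]] \<mu> \<nu> by simp
  then show ?thesis unfolding conv_swap[where f = f and \<mu> = \<mu> and \<nu> = \<nu>] .
next
  assume "a \<noteq> z" "a' \<noteq> z"
  then show ?thesis using absorbing_conv_in_body_no_zero_peak[OF fin card _ f \<mu> _ \<nu>] n3 by simp
qed

theorem theorem1p3:
  fixes Q :: "'a set" and k :: nat
  assumes "finite Q" and "card Q = k" and "k \<ge> 4"
  shows "(\<forall>star. quasigroup_on Q star \<longrightarrow> conv_preserves star (body k Q)) \<and>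
    (\<forall>z diamond. absorbing_zero_quasigroup_on Q z diamond \<longrightarrow> conv_preserves diamond (body k Q)) \<and>
    (\<forall>add z mult. quasigroup_on Q add \<and> absorbing_zero_quasigroup_on Q z mult \<longrightarrow>
       conv_preserves add (body k Q) \<and> conv_preserves mult (body k Q))"
proof -
  define n where "n = k - 1"
  have k: "k = Suc n" and n: "n \<ge> 3" and card: "card Q = Suc n"
    using assms(2,3) by (simp_all add: n_def)
  have n1: "n \<ge> 1" using n by simp
  have peaked: "\<exists>a t. peaked_at n Q p a t" if "p \<in> body k Q" for p
    using body_imp_peaked_at[OF assms(1) card n1] that unfolding k by metis
  have quasi: "conv_preserves f (body k Q)" if q: "quasigroup_on Q f" for f
    unfolding conv_preserves_def
  proof (intro ballI)
    fix \<mu> \<nu> assume "\<mu> \<in> body k Q" "\<nu> \<in> body k Q"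
    then obtain a t a' t' where "peaked_at n Q \<mu> a t" "peaked_at n Q \<nu> a' t'" using peaked by blast
    then show "conv f \<mu> \<nu> \<in> body k Q"
      unfolding k by (rule quasigroup_conv_in_body[OF assms(1) card n1 q])
  qed
  have absorbing: "conv_preserves f (body k Q)" if f: "absorbing_zero_quasigroup_on Q z f" for z f
    unfolding conv_preserves_def
  proof (intro ballI)
    fix \<mu> \<nu> assume "\<mu> \<in> body k Q" "\<nu> \<in> body k Q"
    then obtain a t a' t' where "peaked_at n Q \<mu> a t" "peaked_at n Q \<nu> a' t'" using peaked by blast
    then show "conv f \<mu> \<nu> \<in> body k Q"
      unfolding k by (rule absorbing_conv_in_body[OF assms(1) card n f])
  qed
  show ?thesis using quasi absorbing by blast
qed

end
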